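(* Let $u$ be a weight in $\mathbb R^n$, $w$ a weight in $\mathbb R^+$, and $0<p<\infty$. The following are equivalent: (i) $M:\Lambda^p_u(w)\to\Lambda^p_u(w)$ is bounded. (ii) There is $C<\infty$ such that $\|M\chi_E\|_{\Lambda^p_u(w)}\le C\|\chi_E\|_{\Lambda^p_u(w)}$ for every measurable $E\subset\mathbb R^n$. (iii) There exists $q\in(0,p)$ such that $M:\Lambda^q_u(w)\to\Lambda^q_u(w)$ is bounded. (iv) There exist $q\in(0,p)$ and $C<\infty$ such that $\|M\chi_E\|_{\Lambda^{q,\infty}_u(w)}\le C\|\chi_E\|_{\Lambda^q_u(w)}$ for every measurable $E\subset\mathbb R^n$. (v) There exist $q\in(0,p)$ and $C<\infty$ such that, for every finite family of cubes $(Q_j)_{j=1}^J$ and every family of measurable sets $(E_j)_{j=1}^J$ with $E_j\subset Q_j$ for every $j$, $$\frac{W\big(u\big(\bigcup_jQ_j\big)\big)}{W\big(u\big(\bigcup_jE_j\big)\big)}\le C\max_j\Big(\frac{|Q_j|}{|E_j|}\Big)^q.$$ (vi) There exist $q\in(0,p)$ and $C<\infty$ such that $$\big((M\chi_E)^*_u(t)\big)^q\le C\,\frac{W(u(E))}{W(t)},\qquad t>0,\ E\subset\mathbb R^n\text{ measurable},$$ with $q$ and $C$ independent of $t$ and $E$.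
   Context: $M$ is the Hardy–Littlewood maximal operator $Mf(x)=\sup_{x\in Q}\frac1{|Q|}\int_Q|f(y)|\,dy$, the supremum over all cubes $Q\ni x$ in $\mathbb R^n$ with sides parallel to the axes; all cubes are of this type and $|\cdot|$ is Lebesgue measure. A weight $u$ in $\mathbb R^n$ is a nonnegative locally integrable function, not identically zero; $u(A)=\int_Au(x)\,dx$. A weight $w$ in $\mathbb R^+=(0,\infty)$ is a nonnegative measurable function with $W(t)=\int_0^tw(s)\,ds<\infty$ for all $t<\infty$, supported in $[0,u(\mathbb R^n)]$ and not identically zero. For measurable $f$ on $\mathbb R^n$: $\lambda^u_f(t)=u(\{|f|>t\})$, $f^*_u(t)=\inf\{s>0:\lambda^u_f(s)\le t\}$; for $0<p<\infty$, $\|f\|_{\Lambda^p_u(w)}=\big(\int_0^\infty (f^*_u(t))^pw(t)\,dt\big)^{1/p}$ and $\|f\|_{\Lambda^{p,\infty}_u(w)}=\sup_{t>0}W^{1/p}(t)f^*_u(t)=\sup_{t>0}t\,W^{1/p}(\lambda^u_f(t))$; the spaces consist of the functions for which these are finite. "$M:\Lambda_1\to\Lambda_2$ is bounded" means $\|Mf\|_{\Lambda_2}\le C\|f\|_{\Lambda_1}$ for all measurable $f$ with $\|f\|_{\Lambda_1}<\infty$, $C$ independent of $f$. Conventions: $0/0=\infty/\infty=0\cdot\infty=0$ and $a/0=\infty$ for $a>0$. *)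

theory Defs
  imports "HOL-Analysis.Analysis"
begin

text \<open>
  Measurable means Lebesgue measurable, and \<open>0 / 0 = \<infinity> / \<infinity> = 0 * \<infinity> = 0\<close> and
  \<open>a / 0 = \<infinity>\<close> for \<open>a > 0\<close> are the built-in conventions of \<^typ>\<open>ennreal\<close>.
  Functions on the Euclidean space take values in \<^typ>\<open>ereal\<close>, because the maximal
  function of a finite function may be infinite.
\<close>

text \<open>Powers of extended nonnegative reals; intended for exponents \<open>a > 0\<close> only.\<close>

definition ennreal_powr :: "ennreal \<Rightarrow> real \<Rightarrow> ennreal" where
  "ennreal_powr x a = (if x = top then top else ennreal (enn2real x powr a))"

text \<open>
  Cubes are closed and nondegenerate. Open or half-open cubes would give the same maximal
  function, and they differ from closed ones by null sets.
\<close>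

definition cube :: "(real ^ 'n) set \<Rightarrow> bool" where
  "cube Q \<longleftrightarrow> (\<exists>a l. 0 < l \<and> Q = cbox a (a + (\<chi> i. l)))"

definition maximal_function :: "(real ^ 'n \<Rightarrow> ereal) \<Rightarrow> real ^ 'n \<Rightarrow> ereal" where
  "maximal_function f x = enn2ereal
     (SUP Q \<in> {Q. cube Q \<and> x \<in> Q}.
        (\<integral>\<^sup>+ y\<in>Q. e2ennreal \<bar>f y\<bar> \<partial>lebesgue) / emeasure lebesgue Q)"

definition weight_measure :: "(real ^ 'n \<Rightarrow> real) \<Rightarrow> (real ^ 'n) set \<Rightarrow> ennreal" where
  "weight_measure u A = (\<integral>\<^sup>+ x\<in>A. ennreal (u x) \<partial>lebesgue)"

text \<open>Functions are identified when they agree almost everywhere, hence ``not identically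
  zero'' is read as ``not almost everywhere zero''.\<close>

definition weight :: "(real ^ 'n \<Rightarrow> real) \<Rightarrow> bool" where
  "weight u \<longleftrightarrow>
     u \<in> borel_measurable lebesgue \<and> (\<forall>x. 0 \<le> u x) \<and>
     (\<forall>K. compact K \<longrightarrow> set_integrable lebesgue K u) \<and>
     \<not> (AE x in lebesgue. u x = 0)"

text \<open>The primitive \<open>W\<close> of \<open>w\<close>, also at infinity. Only the values of \<open>w\<close> on the
  positive half-line matter.\<close>

definition primitive :: "(real \<Rightarrow> real) \<Rightarrow> ennreal \<Rightarrow> ennreal" where
  "primitive w t = (\<integral>\<^sup>+ s\<in>{s. 0 < s \<and> ennreal s < t}. ennreal (w s) \<partial>lebesgue)"

definition half_line_weight :: "(real ^ 'n \<Rightarrow> real) \<Rightarrow> (real \<Rightarrow> real) \<Rightarrow> bool" where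
  "half_line_weight u w \<longleftrightarrow>
     w \<in> borel_measurable (lebesgue_on {0<..}) \<and> (\<forall>s>0. 0 \<le> w s) \<and>
     (\<forall>t<top. primitive w t < top) \<and>
     (AE s in lebesgue. 0 < s \<and> weight_measure u UNIV < ennreal s \<longrightarrow> w s = 0) \<and>
     \<not> (AE s in lebesgue. 0 < s \<longrightarrow> w s = 0)"

definition distribution_function ::
    "(real ^ 'n \<Rightarrow> real) \<Rightarrow> (real ^ 'n \<Rightarrow> ereal) \<Rightarrow> real \<Rightarrow> ennreal" where
  "distribution_function u f s = weight_measure u {x. ereal s < \<bar>f x\<bar>}"

text \<open>The infimum of the empty set is \<open>\<infinity>\<close>.\<close>

definition rearrangement ::
    "(real ^ 'n \<Rightarrow> real) \<Rightarrow> (real ^ 'n \<Rightarrow> ereal) \<Rightarrow> real \<Rightarrow> ennreal" where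
  "rearrangement u f t =
     Inf {ennreal s | s. 0 < s \<and> distribution_function u f s \<le> ennreal t}"

definition lorentz_norm ::
    "(real ^ 'n \<Rightarrow> real) \<Rightarrow> (real \<Rightarrow> real) \<Rightarrow> real \<Rightarrow> (real ^ 'n \<Rightarrow> ereal) \<Rightarrow> ennreal" where
  "lorentz_norm u w p f =
     ennreal_powr
       (\<integral>\<^sup>+ t\<in>{0<..}. ennreal_powr (rearrangement u f t) p * ennreal (w t) \<partial>lebesgue)
       (1 / p)"

definition weak_lorentz_norm ::
    "(real ^ 'n \<Rightarrow> real) \<Rightarrow> (real \<Rightarrow> real) \<Rightarrow> real \<Rightarrow> (real ^ 'n \<Rightarrow> ereal) \<Rightarrow> ennreal" where
  "weak_lorentz_norm u w p f =
     (SUP t\<in>{0<..}. ennreal_powr (primitive w (ennreal t)) (1 / p) * rearrangement u f t)"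

text \<open>Boundedness of an operator between the spaces of measurable functions on which the
  functionals \<open>N\<^sub>1\<close> and \<open>N\<^sub>2\<close> are finite.\<close>

definition bounded_operator ::
    "((real ^ 'n \<Rightarrow> ereal) \<Rightarrow> real ^ 'n \<Rightarrow> ereal) \<Rightarrow>
     ((real ^ 'n \<Rightarrow> ereal) \<Rightarrow> ennreal) \<Rightarrow> ((real ^ 'n \<Rightarrow> ereal) \<Rightarrow> ennreal) \<Rightarrow> bool" where
  "bounded_operator T N\<^sub>1 N\<^sub>2 \<longleftrightarrow>
     (\<exists>C<top. \<forall>f \<in> borel_measurable lebesgue. N\<^sub>1 f < top \<longrightarrow> N\<^sub>2 (T f) \<le> C * N\<^sub>1 f)"

end

(*
  Write \<phi>(A) = W(u(A)) and M\<^sub>s E = {M \<chi>\<^sub>E > s}. All six conditions are equivalent to the restricted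
  weak type estimate  \<phi>(M\<^sub>s E) \<le> C s^-q \<phi>(E)  for some q < p, all s > 0 and all measurable E.

  (ii) gives the estimate with an exponent below p. By a Vitali covering of M\<^sub>s E with balls of Whitney
  type, |E \<inter> Q| \<le> \<kappa> s |M\<^sub>s E \<inter> Q| for each cube Q in which E has density at most s, whence
  M\<^bsub>\<kappa>st\<^esub> E \<subseteq> M\<^sub>t (M\<^sub>s E). Summing the norm of M \<chi>\<^sub>E over dyadic levels, (ii) and the pigeonhole
  principle yield, for every E, a level s = \<mu>/\<kappa> with \<mu> in a fixed interval [\<delta>, 1/2] at which
  \<phi>(M\<^sub>s E) \<le> \<mu>^-p \<phi>(E) / 2 \<le> \<mu>^-q \<phi>(E); iterating E \<mapsto> M\<^sub>s E propagates this bound to all levels.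

  Conversely, the estimate forces W to be doubling: a cube Q contains two disjoint cubes of a third of
  its side, one of which carries at most half of u(Q). Doubling makes \<phi> countably subadditive up to
  factors growing like an arbitrarily small power of 2^j, enough to sum the contributions
  of the sets {|f| > 2^(k+j)}, j \<ge> -1, to {Mf > 2^k}, since q < p.
*)
theory Submission
  imports Defs
begin

section \<open>Weights and their primitives\<close>

text \<open>The obstacle is that \<open>\<phi>\<close> is not a measure: \<open>W\<close> need not
  be subadditive, and the Lorentz functionals need not satisfy a triangle inequality. A function
  cannot be split into pieces whose norms are then added; the arguments compare sets through
  \<open>\<phi>\<close> instead. In the iteration a factor \<kappa> lost at each step would
  accumulate to a power that destroys the exponent. It is therefore absorbed into the level: with
  \<mu> = \<kappa> s the inclusion says that the level set of E at \<mu> t lies in the level set at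
  t of the level set of E at \<mu> / \<kappa>. Levels then multiply exactly, and \<kappa>^p is paid
  only once, through the number of dyadic levels among which the pigeonhole principle chooses. The
  level depends on the set, so only its range may be fixed. The lower end \<delta> makes the gained
  factor 1/2 worth a fixed power of \<mu>, which lowers the exponent; the upper end 1/2 makes the
  iteration terminate, since level sets at heights at least 1 are empty. \<open>\<phi>\<close> may
  be infinite. Left continuity of \<open>W\<close> reduces estimates to finite arguments, where
  \<open>W\<close> is finite.\<close>

lemma weight_measure_mono: "A \<subseteq> B \<Longrightarrow> weight_measure u A \<le> weight_measure u B"
  unfolding weight_measure_def by (intro nn_integral_mono) (auto split: split_indicator)

lemma primitive_mono: "s \<le> t \<Longrightarrow> primitive w s \<le> primitive w t"
  unfolding primitive_def by (intro nn_integral_mono) (auto split: split_indicator)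

lemma primitive_0 [simp]: "primitive w 0 = 0"
  unfolding primitive_def by simp

locale lorentz_weights =
  fixes u :: "real ^ 'n \<Rightarrow> real" and w :: "real \<Rightarrow> real"
  assumes weight_u: "weight u" and weight_w: "half_line_weight u w"
begin

definition \<phi> :: "(real ^ 'n) set \<Rightarrow> ennreal" where
  "\<phi> A = primitive w (weight_measure u A)"

lemma phi_mono: "A \<subseteq> B \<Longrightarrow> \<phi> A \<le> \<phi> B"
  unfolding \<phi>_def by (intro primitive_mono weight_measure_mono)

lemma phi_empty [simp]: "\<phi> {} = 0"
  by (simp add: \<phi>_def weight_measure_def)

text \<open>\<open>weight_measure\<close> is a function on all sets. On Lebesgue sets it agrees with
  this measure, which makes additivity and continuity along monotone sequences available.\<close>

definition \<mu> :: "(real ^ 'n) measure" where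
  "\<mu> = density lebesgue (\<lambda>x. ennreal (u x))"

lemma measurable_u [measurable]: "u \<in> borel_measurable lebesgue"
  using weight_u by (simp add: weight_def)

lemma sets_mu [simp, measurable_cong]: "sets \<mu> = sets lebesgue"
  by (simp add: \<mu>_def)

lemma weight_measure_eq: "A \<in> sets lebesgue \<Longrightarrow> weight_measure u A = emeasure \<mu> A"
  by (simp add: weight_measure_def \<mu>_def emeasure_density)

lemma mu_null: "A \<in> null_sets lebesgue \<Longrightarrow> emeasure \<mu> A = 0"
  unfolding \<mu>_def
  using absolutely_continuousI_density[of "\<lambda>x. ennreal (u x)" lebesgue]
  by (auto simp: absolutely_continuous_def null_sets_def)

lemma weight_measure_compact: "compact K \<Longrightarrow> weight_measure u K < top"
proof -
  assume K: "compact K"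
  then have "set_integrable lebesgue K u" using weight_u by (simp add: weight_def)
  then have "integrable lebesgue (\<lambda>x. indicator K x * u x)" by (simp add: set_integrable_def)
  moreover have "weight_measure u K = (\<integral>\<^sup>+ x. ennreal (norm (indicator K x * u x)) \<partial>lebesgue)"
    unfolding weight_measure_def
    using weight_u by (intro nn_integral_cong) (auto split: split_indicator simp: weight_def)
  ultimately show ?thesis by (simp add: integrable_iff_bounded)
qed

lemma measurable_w:
  "(\<lambda>s. ennreal (w s) * indicator {0<..} s) \<in> borel_measurable lebesgue"
proof -
  have "w \<in> borel_measurable (lebesgue_on {0<..})"
    using weight_w by (simp add: half_line_weight_def)
  then have "(\<lambda>s. if s \<in> {0<..} then w s else 0) \<in> borel_measurable lebesgue"
    by (rule borel_measurable_if_I) simp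
  then have "(\<lambda>s. ennreal (if s \<in> {0<..} then w s else 0)) \<in> borel_measurable lebesgue" by measurable
  also have "(\<lambda>s. ennreal (if s \<in> {0<..} then w s else 0)) = (\<lambda>s. ennreal (w s) * indicator {0<..} s)"
    by (auto split: split_indicator)
  finally show ?thesis .
qed

text \<open>The indicator is there because nothing is assumed about \<open>w\<close> on the
  nonpositive half-line.\<close>

definition \<nu> :: "real measure" where
  "\<nu> = density lebesgue (\<lambda>s. ennreal (w s) * indicator {0<..} s)"

lemma sets_nu [simp, measurable_cong]: "sets \<nu> = sets lebesgue"
  by (simp add: \<nu>_def)

lemma sets_below [measurable]: "{s. ennreal s < t} \<in> sets lebesgue"
proof -
  have "{s. ennreal s < t} \<in> sets borel" by measurable
  then show ?thesis by simp
qed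

text \<open>For t > 0 the set on the right also contains every s \<le> 0, because
  \<open>ennreal s\<close> is then 0; \<open>\<nu>\<close> gives these points no mass.\<close>

lemma primitive_eq: "primitive w t = emeasure \<nu> {s. ennreal s < t}"
  unfolding primitive_def \<nu>_def
  by (subst emeasure_density) (auto simp: measurable_w intro!: nn_integral_cong split: split_indicator)

lemma primitive_finite: "primitive w (ennreal t) < top"
  using weight_w by (simp add: half_line_weight_def)

lemma phi_eq: "A \<in> sets lebesgue \<Longrightarrow> \<phi> A = primitive w (emeasure \<mu> A)"
  by (simp add: \<phi>_def weight_measure_eq)

text \<open>The sets {s < t'} increase to {s < t} as t' increases to t, so \<open>W\<close> is left
  continuous, also at t = \<infinity>. An upper bound for \<open>W\<close> at t thus has to be
  checked only at finite positive points strictly below t.\<close>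

lemma primitive_le_by_left_continuity:
  assumes "\<And>s. 0 < s \<Longrightarrow> ennreal s < t \<Longrightarrow> primitive w (ennreal s) \<le> X"
  shows "primitive w t \<le> X"
proof (cases "t = 0")
  case False
  then have "0 < t" by (simp add: zero_less_iff_neq_zero)
  then have "0 \<in> {..<t}" by simp
  then have "{..<t} \<noteq> {}" by (metis empty_iff)
  then obtain f :: "nat \<Rightarrow> ennreal" where f: "incseq f" "range f \<subseteq> {..<t}" "Sup {..<t} = (SUP i. f i)"
    using ennreal_Sup_countable_SUP[of "{..<t}"] by metis
  have "Sup {..<t} = t"
    by (rule Sup_eqI) (auto intro: less_imp_le dense_le)
  then have t: "{s. ennreal s < t} = (\<Union>i. {s. ennreal s < f i})"
    using f(3) by (auto simp: less_SUP_iff)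
  have "primitive w t = (SUP i. emeasure \<nu> {s. ennreal s < f i})"
    unfolding primitive_eq t
    using f(1) by (subst SUP_emeasure_incseq) (auto simp: incseq_def intro: less_le_trans)
  also have "\<dots> \<le> X"
  proof (rule SUP_least)
    fix i
    have lt: "f i < t" using f(2) by auto
    have "primitive w (f i) \<le> X"
    proof (cases "f i = 0")
      case False
      moreover have "f i \<noteq> top" using lt by auto
      ultimately show ?thesis
        using assms[of "enn2real (f i)"] lt
        by (metis enn2real_eq_0_iff enn2real_nonneg ennreal_enn2real_if less_eq_real_def)
    qed simp
    then show "emeasure \<nu> {s. ennreal s < f i} \<le> X" by (simp add: primitive_eq)
  qed
  finally show ?thesis .
qed simp

text \<open>Continuity of \<open>\<phi>\<close> from below: a number strictly below the measure of
  the union is already below the measure of some \<open>A i\<close>.\<close>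

lemma phi_UN_le:
  assumes "\<And>i::nat. A i \<in> sets lebesgue" "incseq A" "\<And>i. \<phi> (A i) \<le> X"
  shows "\<phi> (\<Union>i. A i) \<le> X"
proof -
  have m: "(\<Union>i. A i) \<in> sets lebesgue" using assms by auto
  show ?thesis unfolding phi_eq[OF m]
  proof (rule primitive_le_by_left_continuity)
    fix s assume "0 < s" "ennreal s < emeasure \<mu> (\<Union>i. A i)"
    then have "ennreal s < (SUP i. emeasure \<mu> (A i))"
      using assms by (subst SUP_emeasure_incseq) auto
    then obtain i where "ennreal s < emeasure \<mu> (A i)" by (auto simp: less_SUP_iff)
    then have "primitive w (ennreal s) \<le> \<phi> (A i)" using assms by (simp add: phi_eq primitive_mono)
    then show "primitive w (ennreal s) \<le> X" using assms(3) order_trans by blast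
  qed
qed

text \<open>Otherwise \<open>w\<close> would vanish almost everywhere on the half-line. Doubling
  later upgrades this to positivity of \<open>W\<close> at every positive point.\<close>

lemma primitive_top_pos: "0 < primitive w top"
proof (rule ccontr)
  assume "\<not> ?thesis"
  then have "emeasure \<nu> {s. ennreal s < top} = 0" by (simp add: primitive_eq)
  then have "(\<integral>\<^sup>+s. ennreal (w s) * indicator {0<..} s \<partial>lebesgue) = 0"
    unfolding \<nu>_def by (subst (asm) emeasure_density) (auto simp: measurable_w)
  then have "AE s in lebesgue. ennreal (w s) * indicator {0<..} s = 0"
    using measurable_w by (subst (asm) nn_integral_0_iff_AE) auto
  then have "AE s in lebesgue. 0 < s \<longrightarrow> w s = 0"
    by eventually_elim
      (use weight_w in \<open>auto simp: half_line_weight_def ennreal_eq_0_iff split: split_indicator_asm intro: antisym\<close>)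
  then show False using weight_w by (simp add: half_line_weight_def)
qed

text \<open>\<open>W\<close> is constant beyond the total mass of \<open>u\<close>. Hence doubling
  needs to be checked only at values below the total mass, and these are the measures of
  cubes.\<close>

lemma primitive_le_UNIV: "primitive w t \<le> primitive w (weight_measure u UNIV)"
proof -
  have ae: "AE s in lebesgue. 0 < s \<and> weight_measure u UNIV < ennreal s \<longrightarrow> w s = 0"
    using weight_w by (simp add: half_line_weight_def)
  \<comment> \<open>The support condition speaks of s strictly above the total mass and the integral
    on the right of s strictly below it; the single remaining point is null.\<close>
  have "AE s in lebesgue. s \<noteq> enn2real (weight_measure u UNIV)"
    by (rule AE_completion) (rule AE_lborel_singleton)
  with ae show ?thesis
    unfolding primitive_def
  proof (intro nn_integral_mono_AE, eventually_elim)
    case (elim s)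
    then show ?case
      by (cases "weight_measure u UNIV" rule: ennreal_cases)
        (auto split: split_indicator simp: ennreal_less_iff)
  qed
qed

end

section \<open>Cubes and superlevel sets of the maximal function\<close>

declare emeasure_completion [simp del]

section \<open>Measure-theoretic preliminaries and volumes of cubes\<close>

lemma less_divide_iff_ennreal:
  fixes a b c :: ennreal
  assumes "b \<noteq> 0" "b \<noteq> top"
  shows "c < a / b \<longleftrightarrow> c * b < a"
proof -
  have "a / b \<le> c \<longleftrightarrow> a \<le> c * b"
  proof
    assume "a / b \<le> c"
    then have "a / b * b \<le> c * b" by (rule mult_right_mono) simp
    then show "a \<le> c * b" using assms by (simp add: ennreal_divide_times top.not_eq_extremum)
  next
    assume "a \<le> c * b"
    then have "a / b \<le> c * b / b" by (rule divide_right_mono_ennreal)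
    then show "a / b \<le> c" using assms by (simp add: ennreal_mult_divide_eq)
  qed
  then show ?thesis by (meson not_less)
qed

text \<open>Countable subadditivity in the shape of the exact formula for disjoint unions. A
  covering bound can thus be followed by a termwise estimate and then summed back over disjoint
  sets.\<close>

lemma emeasure_UN_le_count_space:
  assumes "countable I" "\<And>i. i \<in> I \<Longrightarrow> X i \<in> sets M"
  shows "emeasure M (\<Union>i\<in>I. X i) \<le> (\<integral>\<^sup>+i. emeasure M (X i) \<partial>count_space I)"
proof -
  have "emeasure M (\<Union>i\<in>I. X i) = (\<integral>\<^sup>+x. indicator (\<Union>i\<in>I. X i) x \<partial>M)"
    using assms by (subst nn_integral_indicator) (auto intro: sets.countable_UN')
  also have "\<dots> \<le> (\<integral>\<^sup>+x. \<integral>\<^sup>+i. indicator (X i) x \<partial>count_space I \<partial>M)"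
  proof (rule nn_integral_mono)
    fix x
    show "(indicator (\<Union>i\<in>I. X i) x :: ennreal) \<le> (\<integral>\<^sup>+i. indicator (X i) x \<partial>count_space I)"
    proof (cases "x \<in> (\<Union>i\<in>I. X i)")
      case True
      then obtain i where i: "i \<in> I" "x \<in> X i" by auto
      have "indicator (X i) x \<le> (\<integral>\<^sup>+i. (indicator (X i) x :: ennreal) \<partial>count_space I)"
        using i(1) by (rule nn_integral_ge_point)
      then show ?thesis using i True by simp
    qed simp
  qed
  also have "\<dots> = (\<integral>\<^sup>+i. \<integral>\<^sup>+x. indicator (X i) x \<partial>M \<partial>count_space I)"
    using assms by (intro nn_integral_count_space_nn_integral) auto
  also have "\<dots> = (\<integral>\<^sup>+i. emeasure M (X i) \<partial>count_space I)"
    using assms by (intro nn_integral_cong) auto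
  finally show ?thesis .
qed

lemma mem_cube:
  fixes x a :: "real ^ 'n"
  shows "x \<in> cbox a (a + (\<chi> i. l)) \<longleftrightarrow> (\<forall>i. a $ i \<le> x $ i \<and> x $ i \<le> a $ i + l)"
  by (simp add: mem_box_cart)

lemma cube_cbox [simp]: "0 < l \<Longrightarrow> cube (cbox a (a + (\<chi> i. l)))"
  unfolding cube_def by blast

lemma emeasure_cube:
  fixes a :: "real ^ 'n"
  assumes "0 < l"
  shows "emeasure lebesgue (cbox a (a + (\<chi> i. l))) = ennreal (l ^ CARD('n))"
proof -
  have "a \<in> cbox a (a + (\<chi> i. l))" using assms by (simp add: mem_cube)
  then have "cbox a (a + (\<chi> i. l)) \<noteq> {}" by (metis empty_iff)
  then have "measure lborel (cbox a (a + (\<chi> i. l))) = l ^ CARD('n)"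
    by (subst content_cbox_cart) simp_all
  then show ?thesis
    by (simp add: emeasure_eq_measure2[OF lmeasurable_cbox])
qed

lemma cube_pos: "cube Q \<Longrightarrow> emeasure lebesgue Q \<noteq> 0 \<and> emeasure lebesgue Q \<noteq> top"
  by (auto simp: cube_def emeasure_cube)

lemma sets_cube: "cube Q \<Longrightarrow> Q \<in> sets lebesgue"
  by (auto simp: cube_def)

text \<open>The volume depends continuously on the side, so a strict inequality survives a slight
  enlargement. This is what makes superlevel sets of a maximal function over closed cubes
  open.\<close>

lemma cube_enlarge:
  fixes Q :: "(real ^ 'n) set"
  assumes "cube Q" "0 \<le> s" "ennreal s * emeasure lebesgue Q < X"
  obtains Q' where "cube Q'" "Q \<subseteq> interior Q'" "ennreal s * emeasure lebesgue Q' < X"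
proof -
  obtain a l where l: "0 < l" and Q: "Q = cbox a (a + (\<chi> i. l))" using assms(1) by (auto simp: cube_def)
  have "((\<lambda>e. ennreal (s * (l + 2 * e) ^ CARD('n))) \<longlongrightarrow> ennreal (s * (l + 2 * 0) ^ CARD('n))) (at_right 0)"
    by (intro tendsto_intros tendsto_ennrealI)
  moreover have "ennreal (s * (l + 2 * 0) ^ CARD('n)) < X"
    using assms l by (simp add: Q emeasure_cube ennreal_mult'')
  ultimately have "eventually (\<lambda>e. ennreal (s * (l + 2 * e) ^ CARD('n)) < X) (at_right 0)"
    by (rule order_tendstoD)
  then obtain b where b: "0 < b" "\<And>e. 0 < e \<Longrightarrow> e < b \<Longrightarrow> ennreal (s * (l + 2 * e) ^ CARD('n)) < X"
    by (auto simp: eventually_at_right_field)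
  define e where "e = b / 2"
  have e: "0 < e" "ennreal (s * (l + 2 * e) ^ CARD('n)) < X" using b(1) b(2)[of e] by (auto simp: e_def)
  define c where "c = a - (\<chi> i. e)"
  define Q' where "Q' = cbox c (c + (\<chi> i. l + 2 * e))"
  have "Q \<subseteq> box c (c + (\<chi> i. l + 2 * e))"
  proof
    fix x assume "x \<in> Q"
    then have "a $ i \<le> x $ i \<and> x $ i \<le> a $ i + l" for i by (simp add: Q mem_cube)
    then have "a $ i - e < x $ i \<and> x $ i < a $ i - e + (l + 2 * e)" for i using e(1)
      by (smt (verit))
    then show "x \<in> box c (c + (\<chi> i. l + 2 * e))" by (simp add: mem_box_cart c_def)
  qed
  then have "Q \<subseteq> interior Q'" by (simp add: Q'_def)
  moreover have "ennreal s * emeasure lebesgue Q' < X"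
    using e l assms(2) by (simp add: Q'_def emeasure_cube ennreal_mult'')
  ultimately show ?thesis using that[of Q'] e(1) l by (simp add: Q'_def)
qed

text \<open>The set where the maximal function of a nonnegative g exceeds s. The condition on the
  average is multiplied out, so that no quotient of extended reals occurs.\<close>

definition superlevel :: "(real ^ 'n \<Rightarrow> ennreal) \<Rightarrow> real \<Rightarrow> (real ^ 'n) set" where
  "superlevel g s = {x. \<exists>Q. cube Q \<and> x \<in> Q \<and>
     ennreal s * emeasure lebesgue Q < (\<integral>\<^sup>+ y\<in>Q. g y \<partial>lebesgue)}"

text \<open>Besides openness, and hence measurability, this form permits the extraction of countably
  many cubes by the Lindelof property.\<close>

lemma superlevel_eq_UN_interior:
  assumes "0 \<le> s"
  shows "superlevel g s = (\<Union>Q\<in>{Q. cube Q \<and> ennreal s * emeasure lebesgue Q <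
     (\<integral>\<^sup>+ y\<in>Q. g y \<partial>lebesgue)}. interior Q)"
proof (intro equalityI subsetI)
  fix x assume "x \<in> superlevel g s"
  then obtain Q where Q: "cube Q" "x \<in> Q" "ennreal s * emeasure lebesgue Q < (\<integral>\<^sup>+ y\<in>Q. g y \<partial>lebesgue)"
    by (auto simp: superlevel_def)
  obtain Q' where Q': "cube Q'" "Q \<subseteq> interior Q'" "ennreal s * emeasure lebesgue Q' < (\<integral>\<^sup>+ y\<in>Q. g y \<partial>lebesgue)"
    using cube_enlarge[OF Q(1) assms Q(3)] .
  have "(\<integral>\<^sup>+ y\<in>Q. g y \<partial>lebesgue) \<le> (\<integral>\<^sup>+ y\<in>Q'. g y \<partial>lebesgue)"
    using Q'(2) interior_subset[of Q'] by (intro nn_integral_mono) (auto split: split_indicator)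
  then show "x \<in> (\<Union>Q\<in>{Q. cube Q \<and> ennreal s * emeasure lebesgue Q <
     (\<integral>\<^sup>+ y\<in>Q. g y \<partial>lebesgue)}. interior Q)"
    using Q Q' by (auto intro: less_le_trans)
next
  fix x assume "x \<in> (\<Union>Q\<in>{Q. cube Q \<and> ennreal s * emeasure lebesgue Q <
     (\<integral>\<^sup>+ y\<in>Q. g y \<partial>lebesgue)}. interior Q)"
  then show "x \<in> superlevel g s" using interior_subset by (fastforce simp: superlevel_def)
qed

lemma open_superlevel: "0 \<le> s \<Longrightarrow> open (superlevel g s)"
  by (simp add: superlevel_eq_UN_interior open_UN)

lemma sets_superlevel [simp]: "0 \<le> s \<Longrightarrow> superlevel g s \<in> sets lebesgue"
  using open_superlevel[of s g] by simp

lemma superlevel_mono: "(\<And>x. f x \<le> g x) \<Longrightarrow> t \<le> s \<Longrightarrow> superlevel f s \<subseteq> superlevel g t"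
proof
  fix x assume fg: "\<And>x. f x \<le> g x" and ts: "t \<le> s" and "x \<in> superlevel f s"
  then obtain Q where Q: "cube Q" "x \<in> Q" "ennreal s * emeasure lebesgue Q < (\<integral>\<^sup>+ y\<in>Q. f y \<partial>lebesgue)"
    by (auto simp: superlevel_def)
  have "ennreal t * emeasure lebesgue Q \<le> ennreal s * emeasure lebesgue Q"
    using ts by (intro mult_right_mono ennreal_leI) auto
  also note Q(3)
  also have "(\<integral>\<^sup>+ y\<in>Q. f y \<partial>lebesgue) \<le> (\<integral>\<^sup>+ y\<in>Q. g y \<partial>lebesgue)"
    using fg by (intro nn_integral_mono mult_right_mono) auto
  finally show "x \<in> superlevel g t" using Q by (auto simp: superlevel_def)
qed

lemma maximal_function_superlevel:
  assumes "0 \<le> s"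
  shows "{x. ereal s < \<bar>maximal_function f x\<bar>} = superlevel (\<lambda>y. e2ennreal \<bar>f y\<bar>) s"
proof -
  have *: "ereal s < \<bar>enn2ereal z\<bar> \<longleftrightarrow> ennreal s < z" for z
    using assms by (cases z) (auto simp: ennreal_less_iff enn2ereal_ennreal)
  show ?thesis
    unfolding maximal_function_def superlevel_def *
    by (auto simp: less_SUP_iff less_divide_iff_ennreal cube_pos)
qed

abbreviation Mset :: "(real ^ 'n) set \<Rightarrow> real \<Rightarrow> (real ^ 'n) set" where
  "Mset E \<equiv> superlevel (indicator E)"

lemma Mset_eq:
  assumes "E \<in> sets lebesgue"
  shows "Mset E s = {x. \<exists>Q. cube Q \<and> x \<in> Q \<and>
     ennreal s * emeasure lebesgue Q < emeasure lebesgue (E \<inter> Q)}"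
proof -
  have "(\<integral>\<^sup>+ y\<in>Q. indicator E y \<partial>lebesgue) = emeasure lebesgue (E \<inter> Q)" if "cube Q" for Q
    using assms sets_cube[OF that] by (subst indicator_inter_arith[symmetric]) (simp add: sets.Int)
  then show ?thesis unfolding superlevel_def by auto
qed

lemma maximal_function_indicator:
  "0 \<le> s \<Longrightarrow> {x. ereal s < \<bar>maximal_function (indicator E) x\<bar>} = Mset E s"
proof -
  have "(\<lambda>y. e2ennreal \<bar>indicator E y :: ereal\<bar>) = indicator E"
    by (auto split: split_indicator simp: one_ennreal.abs_eq zero_ennreal.abs_eq)
  then show "0 \<le> s \<Longrightarrow> ?thesis" by (simp add: maximal_function_superlevel)
qed

lemma Mset_empty_of_ge_1:
  assumes "E \<in> sets lebesgue" "1 \<le> s"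
  shows "Mset E s = {}"
proof -
  have "\<not> ennreal s * emeasure lebesgue Q < emeasure lebesgue (E \<inter> Q)" if "cube Q" for Q
  proof -
    have "emeasure lebesgue (E \<inter> Q) \<le> 1 * emeasure lebesgue Q"
      using sets_cube[OF that] by (simp add: emeasure_mono)
    also have "\<dots> \<le> ennreal s * emeasure lebesgue Q"
      using assms by (intro mult_right_mono) auto
    finally show ?thesis by simp
  qed
  then show ?thesis using assms by (auto simp: Mset_eq)
qed

lemma emeasure_le_of_notin_Mset:
  assumes "E \<in> sets lebesgue" "cube Q" "x \<in> Q" "x \<notin> Mset E s"
  shows "emeasure lebesgue (E \<inter> Q) \<le> ennreal s * emeasure lebesgue Q"
  using assms by (force simp: Mset_eq not_less)

text \<open>A weak form of the Lebesgue density theorem. A piece A of the difference with positive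
  measure m would lie in an open set T with |T| < m / s. Nonoverlapping dyadic cubes inside T that
  meet A cover A, and E has density at most s in each of them, so m \<le> s |T| < m.\<close>

lemma null_sets_diff_Mset:
  fixes E :: "(real ^ 'n) set"
  assumes E: "E \<in> sets lebesgue" and s: "0 < s" "s < 1"
  shows "E - Mset E s \<in> null_sets lebesgue"
proof -
  define B :: "nat \<Rightarrow> (real ^ 'n) set" where
    "B k = cbox (\<chi> i. - real (Suc k)) ((\<chi> i. - real (Suc k)) + (\<chi> i. 2 * real (Suc k)))" for k
  have Bbox: "B k = cbox (\<chi> i. - real (Suc k)) (\<chi> i. real (Suc k))" for k
    by (simp add: B_def plus_vec_def)
  have null: "(E - Mset E s) \<inter> B k \<in> null_sets lebesgue" for k
  proof (rule ccontr)
    define A where "A = (E - Mset E s) \<inter> B k"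
    assume notnull: "(E - Mset E s) \<inter> B k \<notin> null_sets lebesgue"
    have "cube (B k)" by (simp add: B_def)
    have A: "A \<in> sets lebesgue" unfolding A_def using E s sets_cube[OF \<open>cube (B k)\<close>] by (intro sets.Int sets.Diff sets_superlevel) auto
    have "emeasure lebesgue A \<le> emeasure lebesgue (B k)"
      by (rule emeasure_mono) (auto simp: A_def B_def)
    also have "\<dots> < top" using cube_pos[OF \<open>cube (B k)\<close>] by (simp add: top.not_eq_extremum)
    finally have fin: "emeasure lebesgue A < top" .
    define m where "m = measure lebesgue A"
    have m: "emeasure lebesgue A = ennreal m" using fin by (simp add: m_def emeasure_eq_ennreal_measure)
    have "m \<noteq> 0" using notnull A m by (auto simp: A_def null_sets_def)
    then have mpos: "0 < m" by (simp add: m_def zero_less_measure_iff)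
    \<comment> \<open>This is the excess m / s - m that |T| may have over |A|.\<close>
    have "0 < m * (1 / s - 1)" using mpos s by simp
    then obtain T where T: "open T" "A \<subseteq> T" "emeasure lebesgue (T - A) < ennreal (m * (1 / s - 1))"
      using sets_lebesgue_outer_open[OF A] by metis
    have Ts: "T \<in> sets lebesgue" using T(1) by simp
    have "emeasure lebesgue T = emeasure lebesgue A + emeasure lebesgue (T - A)"
      using A Ts T(2) by (subst plus_emeasure) (auto intro: arg_cong[where f="emeasure lebesgue"])
    also have "\<dots> < ennreal m + ennreal (m * (1 / s - 1))"
      unfolding m using T(3) by (simp add: ennreal_add_left_cancel_less)
    also have "\<dots> = ennreal (m / s)"
      using mpos s by (subst ennreal_plus[symmetric]) (auto simp: field_simps)
    finally have "ennreal s * emeasure lebesgue T < ennreal s * ennreal (m / s)"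
      using s by (intro ennreal_mult_strict_left_mono) auto
    also have "\<dots> = ennreal m" using s mpos by (simp add: ennreal_mult[symmetric])
    finally have Tm: "ennreal s * emeasure lebesgue T < ennreal m" .
    \<comment> \<open>A covering cube K comes with a point x of A and K \<subseteq> g x. This gauge
      thereby keeps all covering cubes inside T.\<close>
    define g where "g x = (if x \<in> T then T else UNIV)" for x
    have "gauge g" using T(1) by (auto simp: gauge_def g_def)
    have "A \<subseteq> cbox (\<chi> i. - real (Suc k)) (\<chi> i. real (Suc k))" by (auto simp: A_def Bbox)
    moreover have "box (\<chi> i. - real (Suc k)) (\<chi> i. real (Suc k) :: real ^ 'n) \<noteq> {}"
      by (simp add: interval_ne_empty_cart)
    ultimately obtain D where D: "countable D"
      "\<And>K. K \<in> D \<Longrightarrow> interior K \<noteq> {} \<and> (\<exists>c d. K = cbox c d)"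
      "pairwise (\<lambda>A B. interior A \<inter> interior B = {}) D"
      "\<And>K. K \<in> D \<Longrightarrow> \<exists>x \<in> A \<inter> K. K \<subseteq> g x"
      "\<And>a b. cbox a b \<in> D \<Longrightarrow> \<exists>n. \<forall>i \<in> Basis. b \<bullet> i - a \<bullet> i =
         ((\<chi> i. real (Suc k)) \<bullet> i - (\<chi> i. - real (Suc k)) \<bullet> i) / 2 ^ n"
      "A \<subseteq> \<Union>D"
      using covering_lemma[OF _ _ \<open>gauge g\<close>, of A "\<chi> i. - real (Suc k)" "\<chi> i. real (Suc k)"] by metis
    \<comment> \<open>The covering boxes arise from repeated halving of the surrounding box. That
      box is a cube, hence so are they.\<close>
    have cubes: "cube K" if "K \<in> D" for K
    proof -
      obtain c d where K: "K = cbox c d" using D(2)[OF \<open>K \<in> D\<close>] by auto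
      obtain n where n: "\<forall>i \<in> Basis. d \<bullet> i - c \<bullet> i =
         ((\<chi> i. real (Suc k)) \<bullet> i - (\<chi> i. - real (Suc k)) \<bullet> i) / 2 ^ n"
        using D(5) \<open>K \<in> D\<close> K by blast
      have "d $ i = c $ i + 2 * real (Suc k) / 2 ^ n" for i
      proof -
        have "d \<bullet> axis i 1 - c \<bullet> axis i 1 =
           ((\<chi> i. real (Suc k)) \<bullet> axis i 1 - (\<chi> i. - real (Suc k)) \<bullet> axis i 1) / 2 ^ n"
          using n by (auto simp: Basis_vec_def)
        then show ?thesis by (simp add: cart_eq_inner_axis[symmetric] algebra_simps)
      qed
      then have "d = c + (\<chi> i. 2 * real (Suc k) / 2 ^ n)" by (simp add: vec_eq_iff)
      then show ?thesis unfolding K by (auto intro: cube_cbox)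
    qed
    have "emeasure lebesgue A \<le> emeasure lebesgue (\<Union>K\<in>D. A \<inter> K)"
      using D(6) A D(1) cubes by (intro emeasure_mono sets.countable_UN') (auto intro: sets_cube)
    also have "\<dots> \<le> (\<integral>\<^sup>+K. emeasure lebesgue (A \<inter> K) \<partial>count_space D)"
      using D(1) A cubes by (intro emeasure_UN_le_count_space) (auto intro: sets_cube)
    also have "\<dots> \<le> (\<integral>\<^sup>+K. ennreal s * emeasure lebesgue (interior K) \<partial>count_space D)"
    proof (rule nn_integral_mono)
      fix K assume "K \<in> space (count_space D)"
      then have K: "K \<in> D" by simp
      obtain x where x: "x \<in> A" "x \<in> K" using D(4)[OF K] by auto
      have "emeasure lebesgue (A \<inter> K) \<le> emeasure lebesgue (E \<inter> K)"
        using E cubes[OF K] by (intro emeasure_mono) (auto simp: A_def intro: sets_cube)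
      also have "\<dots> \<le> ennreal s * emeasure lebesgue K"
        using E cubes[OF K] x by (intro emeasure_le_of_notin_Mset[of E K x]) (auto simp: A_def)
      also have "emeasure lebesgue K = emeasure lebesgue (interior K)"
        using D(2)[OF K] by (auto simp: emeasure_completion emeasure_lborel_box_eq emeasure_lborel_cbox_eq interior_cbox box_eq_empty)
      finally show "emeasure lebesgue (A \<inter> K) \<le> ennreal s * emeasure lebesgue (interior K)" .
    qed
    also have "\<dots> = ennreal s * emeasure lebesgue (\<Union>K\<in>D. interior K)"
      using D(1,3)
      by (subst nn_integral_cmult, simp, subst emeasure_UN_countable)
        (auto simp: disjoint_family_on_def pairwise_def)
    also have "\<dots> \<le> ennreal s * emeasure lebesgue T"
    proof (intro mult_left_mono emeasure_mono)
      show "(\<Union>K\<in>D. interior K) \<subseteq> T"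
      proof (rule UN_least)
        fix K assume "K \<in> D"
        then obtain x where "x \<in> A" "K \<subseteq> g x" using D(4) by blast
        then show "interior K \<subseteq> T" using T(2) interior_subset[of K] by (auto simp: g_def split: if_splits)
      qed
    qed (use Ts in auto)
    finally show False using Tm m by simp
  qed
  have "E - Mset E s \<subseteq> (\<Union>k. (E - Mset E s) \<inter> B k)"
  proof
    fix x assume x: "x \<in> E - Mset E s"
    obtain k where k: "norm x \<le> real k" using real_arch_simple by blast
    have "\<bar>x $ i\<bar> \<le> real (Suc k)" for i
      using component_le_norm_cart[of x i] k by simp
    then have "- real (Suc k) \<le> x $ i \<and> x $ i \<le> real (Suc k)" for i
      by (smt (verit))
    then have "x \<in> B k" by (simp add: Bbox mem_box_cart)
    then show "x \<in> (\<Union>k. (E - Mset E s) \<inter> B k)" using x by blast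
  qed
  moreover have "(\<Union>k. (E - Mset E s) \<inter> B k) \<in> null_sets lebesgue"
    using null by (intro null_sets_UN)
  ultimately have "E - Mset E s = (\<Union>k. (E - Mset E s) \<inter> B k)" by auto
  then show ?thesis using \<open>(\<Union>k. (E - Mset E s) \<inter> B k) \<in> null_sets lebesgue\<close> by simp
qed

section \<open>A covering estimate\<close>

lemma dist_le_of_components:
  fixes x y :: "real ^ 'n"
  assumes "\<And>i. \<bar>x $ i - y $ i\<bar> \<le> h"
  shows "dist x y \<le> real CARD('n) * h"
proof -
  have "dist x y \<le> (\<Sum>i\<in>UNIV. \<bar>(x - y) $ i\<bar>)"
    unfolding dist_norm by (rule norm_le_l1_cart)
  also have "\<dots> \<le> (\<Sum>i\<in>(UNIV::'n set). h)"
    using assms by (intro sum_mono) simp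
  finally show ?thesis by simp
qed

text \<open>The second point z of Q forces the side of Q to be at least 2 r / n. Hence a cube of
  side r / n with y among its vertices fits into Q, and its diameter is at most r.\<close>

lemma cball_inter_cube_ge:
  fixes y :: "real ^ 'n"
  assumes "cube Q" "y \<in> Q" "0 < r" "z \<in> Q" "2 * r \<le> dist y z"
  shows "ennreal ((r / real CARD('n)) ^ CARD('n)) \<le> emeasure lebesgue (cball y r \<inter> Q)"
proof -
  obtain a l where l: "0 < l" and Q: "Q = cbox a (a + (\<chi> i. l))" using assms(1) by (auto simp: cube_def)
  define n where "n = real CARD('n)"
  have n: "0 < n" by (simp add: n_def)
  define h where "h = r / n"
  have h: "0 < h" using assms n by (simp add: h_def)
  have ya: "a $ i \<le> y $ i" "y $ i \<le> a $ i + l" for i using assms(2) by (auto simp: Q mem_cube)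
  have za: "a $ i \<le> z $ i" "z $ i \<le> a $ i + l" for i using assms(4) by (auto simp: Q mem_cube)
  have "dist y z \<le> n * l"
    unfolding n_def by (rule dist_le_of_components) (use ya za in \<open>smt (verit)\<close>)
  then have "r \<le> n * (l / 2)" using assms(5) by simp
  then have hl: "h \<le> l / 2" using n by (simp add: h_def field_simps)
  \<comment> \<open>In each coordinate the small cube extends from y towards the farther face of Q,
    where at least l / 2 \<ge> h of room is left.\<close>
  define b :: "real ^ 'n" where "b = (\<chi> i. if y $ i \<le> a $ i + l / 2 then y $ i else y $ i - h)"
  have b: "b $ i \<le> y $ i" "y $ i \<le> b $ i + h" "a $ i \<le> b $ i" "b $ i + h \<le> a $ i + l" for i
    using h hl ya[of i] by (auto simp: b_def)
  have "cbox b (b + (\<chi> i. h)) \<subseteq> cball y r \<inter> Q"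
  proof
    fix x assume "x \<in> cbox b (b + (\<chi> i. h))"
    then have x: "b $ i \<le> x $ i" "x $ i \<le> b $ i + h" for i by (auto simp: mem_cube)
    have "dist y x \<le> n * h"
      unfolding n_def by (rule dist_le_of_components) (use x b in \<open>smt (verit)\<close>)
    then have "x \<in> cball y r" using n by (simp add: h_def)
    moreover have "x \<in> Q" unfolding Q mem_cube using x b by (smt (verit))
    ultimately show "x \<in> cball y r \<inter> Q" by simp
  qed
  then have "emeasure lebesgue (cbox b (b + (\<chi> i. h))) \<le> emeasure lebesgue (cball y r \<inter> Q)"
    using sets_cube[OF assms(1)] by (intro emeasure_mono) auto
  then show ?thesis using h by (simp add: emeasure_cube h_def n_def)
qed

text \<open>The ratio of the volumes of a cube of side 10 r, circumscribed about a ball of radius 5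
  r, and of a cube of side r / n, which the ball of radius r is sure to share with Q.\<close>

definition kappa :: "'n itself \<Rightarrow> real" where
  "kappa _ = (10 * real CARD('n)) ^ CARD('n)"

lemma kappa_ge_1: "1 \<le> kappa TYPE('n::finite)"
proof -
  have "1 \<le> real CARD('n)" by (simp add: Suc_le_eq)
  then show ?thesis unfolding kappa_def by (intro one_le_power) linarith
qed

text \<open>Balls of radius half the distance to the complement of \<open>Mset E s\<close> play the role of the
  cubes of a Whitney decomposition: the concentric cubes of five times this radius meet the
  complement, so \<open>E\<close> has density at most \<open>s\<close> in them.\<close>

lemma emeasure_inter_le_Mset:
  fixes E Q :: "(real ^ 'n) set"
  assumes E: "E \<in> sets lebesgue" and s: "0 < s" "s < 1" and Q: "cube Q"
    and le: "emeasure lebesgue (E \<inter> Q) \<le> ennreal s * emeasure lebesgue Q"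
  shows "emeasure lebesgue (E \<inter> Q) \<le> ennreal (kappa TYPE('n) * s) * emeasure lebesgue (Mset E s \<inter> Q)"
proof -
  define M where "M = Mset E s"
  define k where "k = kappa TYPE('n)"
  have k: "1 \<le> k" unfolding k_def by (rule kappa_ge_1)
  have openM: "open M" using s by (simp add: M_def open_superlevel)
  have M: "M \<in> sets lebesgue" using s by (simp add: M_def)
  have Qs: "Q \<in> sets lebesgue" using Q by (rule sets_cube)
  show ?thesis
  proof (cases "Q \<subseteq> M")
    case True
    have "emeasure lebesgue (E \<inter> Q) \<le> ennreal s * emeasure lebesgue Q" by (rule le)
    also have "\<dots> \<le> ennreal (k * s) * emeasure lebesgue Q"
      using k s by (intro mult_right_mono ennreal_leI) auto
    also have "emeasure lebesgue Q = emeasure lebesgue (M \<inter> Q)" using True by (simp add: Int_absorb1)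
    finally show ?thesis by (simp add: M_def k_def)
  next
    case False
    \<comment> \<open>This point does three things: it makes the complement nonempty, without which
      \<open>infdist\<close> would be 0; it bounds the radii by the size of Q; and it is the second
      point of Q that the volume bound for balls centred in Q requires.\<close>
    then obtain y0 where y0: "y0 \<in> Q" "y0 \<in> - M" by auto
    define r where "r y = infdist y (- M) / 2" for y
    have closedM: "closed (- M)" using openM by (simp add: closed_Compl)
    have rpos: "0 < r y" if "y \<in> M" for y
    proof -
      have "infdist y (- M) \<noteq> 0"
        using that y0 closedM in_closed_iff_infdist_zero[of "- M" y] by auto
      then show ?thesis using infdist_nonneg[of y "- M"] by (simp add: r_def)
    qed
    have rle: "2 * r y \<le> dist y y0" for y unfolding r_def using infdist_le[OF y0(2), of y] by simp
    have bounded: "bounded Q" using Q by (metis cube_def bounded_cbox)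
    then obtain B where "\<forall>y\<in>Q. dist y0 y \<le> B"
      unfolding bounded_any_center[of Q y0] by blast
    then have B: "dist y y0 \<le> B" if "y \<in> Q" for y using that by (metis dist_commute)
    have radii: "0 < r y \<and> r y \<le> B" if "y \<in> M \<inter> Q" for y
      using rpos[of y] rle[of y] B[of y] that by auto
    obtain C where C: "countable C" "C \<subseteq> M \<inter> Q"
      "pairwise (\<lambda>i j. disjnt (cball i (r i)) (cball j (r j))) C"
      "\<And>i. i \<in> M \<inter> Q \<Longrightarrow> \<exists>j. j \<in> C \<and> \<not> disjnt (cball i (r i)) (cball j (r j)) \<and> cball i (r i) \<subseteq> ball j (5 * r j)"
      by (rule Vitali_covering_lemma_cballs_balls[of "M \<inter> Q" r B "\<lambda>x. x", OF radii]) (assumption, rule that)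
    \<comment> \<open>Averages over cubes are the ones controlled outside \<open>M\<close>, so the
      balls enlarged five times are replaced by their circumscribed cubes.\<close>
    define P :: "real ^ 'n \<Rightarrow> (real ^ 'n) set" where
      "P y = cbox (y - (\<chi> i. 5 * r y)) ((y - (\<chi> i. 5 * r y)) + (\<chi> i. 10 * r y))" for y
    have memP: "x \<in> P y" if "dist y x \<le> 5 * r y" for x y
    proof -
      have "\<bar>y $ i - x $ i\<bar> \<le> 5 * r y" for i
        using that component_le_norm_cart[of "y - x" i] by (simp add: dist_norm)
      then show ?thesis by (simp add: P_def mem_cube abs_le_iff) (smt (verit))
    qed
    have cubeP: "cube (P y)" if "y \<in> C" for y
      unfolding P_def using rpos[of y] C(2) that by (intro cube_cbox) auto
    have cover: "M \<inter> Q \<subseteq> (\<Union>y\<in>C. P y)"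
    proof
      fix x assume x: "x \<in> M \<inter> Q"
      then obtain y where y: "y \<in> C" "cball x (r x) \<subseteq> ball y (5 * r y)" using C(4) by blast
      have "x \<in> cball x (r x)" using rpos x by (simp add: less_imp_le)
      then have "dist y x \<le> 5 * r y" using y(2) by (auto simp: subset_iff less_imp_le)
      then show "x \<in> (\<Union>y\<in>C. P y)" using y(1) memP by blast
    qed
    have EP: "emeasure lebesgue (E \<inter> P y) \<le> ennreal (k * s) * emeasure lebesgue (cball y (r y) \<inter> Q)"
      if "y \<in> C" for y
    proof -
      have ry: "0 < r y" "y \<in> Q" using that C(2) rpos by auto
      obtain z where z: "z \<in> - M" "infdist y (- M) = dist y z"
        using infdist_attains_inf[OF closedM, of y] y0 by auto
      then have "z \<in> P y" using ry by (intro memP) (simp add: r_def)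
      then have "emeasure lebesgue (E \<inter> P y) \<le> ennreal s * emeasure lebesgue (P y)"
        using E cubeP[OF that] z(1) by (intro emeasure_le_of_notin_Mset[of E "P y" z]) (auto simp: M_def)
      also have "emeasure lebesgue (P y) = ennreal ((10 * r y) ^ CARD('n))"
        unfolding P_def using ry by (intro emeasure_cube) simp
      also have "(10 * r y) ^ CARD('n) = k * (r y / real CARD('n)) ^ CARD('n)"
        unfolding k_def kappa_def power_mult_distrib[symmetric] by (rule arg_cong[where f="\<lambda>z. z ^ CARD('n)"]) simp
      also have "ennreal s * ennreal (k * (r y / real CARD('n)) ^ CARD('n)) =
         ennreal (k * s) * ennreal ((r y / real CARD('n)) ^ CARD('n))"
        using k s ry by (simp add: ennreal_mult[symmetric] mult_ac)
      also have "\<dots> \<le> ennreal (k * s) * emeasure lebesgue (cball y (r y) \<inter> Q)"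
        using cball_inter_cube_ge[OF Q ry(2) ry(1) y0(1) rle] by (intro mult_left_mono) auto
      finally show ?thesis .
    qed
    have EPs: "E \<inter> P y \<in> sets lebesgue" if "y \<in> C" for y
      by (rule sets.Int[OF E sets_cube[OF cubeP[OF that]]])
    have U: "(\<Union>y\<in>C. E \<inter> P y) \<in> sets lebesgue"
      by (rule sets.countable_UN'[OF C(1)]) (use EPs in auto)
    have EM: "E - M \<in> sets lebesgue" using E M by (rule sets.Diff)
    have "E \<inter> Q \<subseteq> (E - M) \<union> (\<Union>y\<in>C. E \<inter> P y)"
    proof
      fix x assume x: "x \<in> E \<inter> Q"
      show "x \<in> (E - M) \<union> (\<Union>y\<in>C. E \<inter> P y)"
      proof (cases "x \<in> M")
        case True
        then have "x \<in> (\<Union>y\<in>C. P y)" using x by (intro subsetD[OF cover]) simp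
        then show ?thesis using x by (simp only: UN_iff Int_iff Un_iff) (metis IntE)
      qed (use x in simp)
    qed
    then have "emeasure lebesgue (E \<inter> Q) \<le> emeasure lebesgue ((E - M) \<union> (\<Union>y\<in>C. E \<inter> P y))"
      by (rule emeasure_mono) (rule sets.Un[OF EM U])
    also have "\<dots> \<le> emeasure lebesgue (E - M) + emeasure lebesgue (\<Union>y\<in>C. E \<inter> P y)"
      using EM U by (rule emeasure_subadditive)
    also have "emeasure lebesgue (E - M) = 0"
      using null_sets_diff_Mset[OF E s] by (simp add: M_def null_sets_def)
    also have "0 + emeasure lebesgue (\<Union>y\<in>C. E \<inter> P y) \<le>
        (\<integral>\<^sup>+y. emeasure lebesgue (E \<inter> P y) \<partial>count_space C)"
      unfolding add_0 using C(1) EPs by (rule emeasure_UN_le_count_space)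
    also have "\<dots> \<le> (\<integral>\<^sup>+y. ennreal (k * s) * emeasure lebesgue (cball y (r y) \<inter> Q) \<partial>count_space C)"
      using EP by (intro nn_integral_mono) auto
    \<comment> \<open>The selected balls are disjoint, so the sum over balls becomes the measure of
      a union, which lies in \<open>M\<close> because the radii are only half the distance to the
      complement.\<close>
    also have "\<dots> = ennreal (k * s) * emeasure lebesgue (\<Union>y\<in>C. cball y (r y) \<inter> Q)"
      using C(1,3) Qs
      by (subst nn_integral_cmult, simp, subst emeasure_UN_countable)
        (auto simp: disjoint_family_on_def pairwise_def disjnt_def)
    also have "\<dots> \<le> ennreal (k * s) * emeasure lebesgue (M \<inter> Q)"
    proof (intro mult_left_mono emeasure_mono)
      have "cball y (r y) \<subseteq> M" if "y \<in> C" for y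
      proof
        fix x assume "x \<in> cball y (r y)"
        then have "dist y x \<le> r y" by simp
        show "x \<in> M"
        proof (rule ccontr)
          assume "x \<notin> M"
          then have "infdist y (- M) \<le> dist y x" by (intro infdist_le) auto
          with \<open>dist y x \<le> r y\<close> rpos[of y] that C(2) show False by (auto simp: r_def)
        qed
      qed
      then show "(\<Union>y\<in>C. cball y (r y) \<inter> Q) \<subseteq> M \<inter> Q" by blast
    qed (use M Qs in auto)
    finally show ?thesis by (simp add: M_def k_def)
  qed
qed

text \<open>If E has density at most s in a cube Q, the covering estimate transfers the average of E
  over Q to \<open>Mset E s\<close>, and the factor \<kappa> s cancels. If the density is larger, Q
  lies in \<open>Mset E s\<close> altogether, and the average 1 exceeds t.\<close>

lemma Mset_subset_Mset_Mset:
  fixes E :: "(real ^ 'n) set"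
  assumes E: "E \<in> sets lebesgue" and s: "0 < s" "s < 1" and t: "0 < t" "t < 1"
  shows "Mset E (kappa TYPE('n) * s * t) \<subseteq> Mset (Mset E s) t"
proof
  define k where "k = kappa TYPE('n)"
  have k: "1 \<le> k" unfolding k_def by (rule kappa_ge_1)
  have Ms: "Mset E s \<in> sets lebesgue" using s by simp
  fix x assume "x \<in> Mset E (kappa TYPE('n) * s * t)"
  then obtain Q where Q: "cube Q" "x \<in> Q" "ennreal (k * s * t) * emeasure lebesgue Q < emeasure lebesgue (E \<inter> Q)"
    using E by (auto simp: Mset_eq k_def)
  have "ennreal t * emeasure lebesgue Q < emeasure lebesgue (Mset E s \<inter> Q)"
  proof (cases "emeasure lebesgue (E \<inter> Q) \<le> ennreal s * emeasure lebesgue Q")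
    case True
    have "ennreal (k * s) * (ennreal t * emeasure lebesgue Q) = ennreal (k * s * t) * emeasure lebesgue Q"
      using k s t by (simp add: ennreal_mult mult_ac)
    also have "\<dots> < ennreal (k * s) * emeasure lebesgue (Mset E s \<inter> Q)"
      using Q(3) emeasure_inter_le_Mset[OF E s Q(1) True] by (simp add: k_def)
    finally show ?thesis using mult_left_mono[of "emeasure lebesgue (Mset E s \<inter> Q)" _ "ennreal (k * s)"]
      by (meson not_less zero_le)
  next
    case False
    then have "Q \<subseteq> Mset E s" using E Q(1) by (auto simp: Mset_eq not_le)
    then have "Mset E s \<inter> Q = Q" by auto
    moreover have "ennreal t * emeasure lebesgue Q < 1 * emeasure lebesgue Q"
      using cube_pos[OF Q(1)] t
      by (subst (1 2) mult.commute, intro ennreal_mult_strict_left_mono)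
        (auto simp: zero_less_iff_neq_zero top.not_eq_extremum)
    ultimately show ?thesis by simp
  qed
  then show "x \<in> Mset (Mset E s) t" using Q Ms by (auto simp: Mset_eq)
qed

section \<open>Dyadic form of the Lorentz norms\<close>

lemma ennreal_powr_ennreal: "0 \<le> r \<Longrightarrow> ennreal_powr (ennreal r) a = ennreal (r powr a)"
  by (simp add: ennreal_powr_def)

lemma ennreal_powr_top [simp]: "ennreal_powr top a = top"
  by (simp add: ennreal_powr_def)

lemma ennreal_powr_0 [simp]: "ennreal_powr 0 a = 0"
  by (simp add: ennreal_powr_def)

lemma two_powr_uminus_less_1: "0 < p \<Longrightarrow> 2 powr - p < (1 :: real)"
  using powr_less_mono[of "- p" 0 "2 :: real"] by simp

lemma ennreal_powr_mono:
  assumes "0 \<le> a" "x \<le> y"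
  shows "ennreal_powr x a \<le> ennreal_powr y a"
proof (cases y)
  case (real r)
  then obtain s where "x = ennreal s" "0 \<le> s" using assms(2) by (cases x) (auto simp: top_unique)
  then show ?thesis using real assms by (simp add: ennreal_powr_ennreal powr_mono2)
qed simp

lemma ennreal_powr_powr:
  assumes "a \<noteq> 0"
  shows "ennreal_powr (ennreal_powr x a) (1 / a) = x" "ennreal_powr (ennreal_powr x (1 / a)) a = x"
  using assms by (cases x; simp add: ennreal_powr_ennreal powr_powr)+

lemma ennreal_powr_mult:
  assumes "0 < c"
  shows "ennreal_powr (ennreal c * x) a = ennreal (c powr a) * ennreal_powr x a"
proof (cases x)
  case (real r)
  then show ?thesis using assms
    by (simp add: ennreal_mult[symmetric] ennreal_powr_ennreal powr_mult)
next
  case top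
  then show ?thesis using assms by (simp add: ennreal_mult_top)
qed

lemma ennreal_powr_le_iff:
  assumes "0 < c" "0 < p"
  shows "ennreal_powr x (1 / p) \<le> ennreal c * ennreal_powr y (1 / p) \<longleftrightarrow> x \<le> ennreal (c powr p) * y"
proof
  assume "ennreal_powr x (1 / p) \<le> ennreal c * ennreal_powr y (1 / p)"
  then have "ennreal_powr (ennreal_powr x (1 / p)) p \<le> ennreal_powr (ennreal c * ennreal_powr y (1 / p)) p"
    using assms by (intro ennreal_powr_mono) auto
  then show "x \<le> ennreal (c powr p) * y" using assms by (simp add: ennreal_powr_mult ennreal_powr_powr)
next
  assume "x \<le> ennreal (c powr p) * y"
  then have "ennreal_powr x (1 / p) \<le> ennreal_powr (ennreal (c powr p) * y) (1 / p)"
    using assms by (intro ennreal_powr_mono) auto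
  then show "ennreal_powr x (1 / p) \<le> ennreal c * ennreal_powr y (1 / p)"
    using assms by (simp add: ennreal_powr_mult powr_powr)
qed

section \<open>Distribution functions and rearrangements\<close>

lemma distribution_function_antimono: "s \<le> t \<Longrightarrow> distribution_function u f t \<le> distribution_function u f s"
  unfolding distribution_function_def by (intro weight_measure_mono) (auto intro: le_less_trans[of "ereal s" "ereal t"])

lemma rearrangement_le: "0 < s \<Longrightarrow> distribution_function u f s \<le> ennreal t \<Longrightarrow> rearrangement u f t \<le> ennreal s"
  unfolding rearrangement_def by (intro Inf_lower) auto

lemma rearrangement_ge: "ennreal t < distribution_function u f s \<Longrightarrow> ennreal s \<le> rearrangement u f t"
  unfolding rearrangement_def
proof (intro Inf_greatest)
  fix z assume t: "ennreal t < distribution_function u f s"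
    and "z \<in> {ennreal s |s. 0 < s \<and> distribution_function u f s \<le> ennreal t}"
  then obtain r where r: "z = ennreal r" "distribution_function u f r \<le> ennreal t" by auto
  have "s \<le> r"
    using t r(2) distribution_function_antimono[of r s u f] by (meson le_cases le_less_trans not_less)
  then show "ennreal s \<le> z" by (simp add: r(1) ennreal_leI)
qed

lemma rearrangement_indicator:
  "rearrangement u (indicator E) t = indicator {t. ennreal t < weight_measure u E} t"
proof -
  have D: "distribution_function u (indicator E) s = (if s < 1 then weight_measure u E else 0)" if "0 < s" for s
  proof -
    have "{x. ereal s < \<bar>indicator E x\<bar>} = (if s < 1 then E else {})"
    proof (rule set_eqI)
      fix x show "x \<in> {x. ereal s < \<bar>indicator E x\<bar>} \<longleftrightarrow> x \<in> (if s < 1 then E else {})"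
        using that by (cases "x \<in> E") (auto simp: one_ereal_def)
    qed
    then show ?thesis by (simp add: distribution_function_def weight_measure_def)
  qed
  show ?thesis
  proof (cases "ennreal t < weight_measure u E")
    case True
    have "rearrangement u (indicator E) t = 1"
    proof (rule antisym)
      show "rearrangement u (indicator E) t \<le> 1" using rearrangement_le[of 1 u "indicator E" t] D[of 1] by simp
      show "1 \<le> rearrangement u (indicator E) t"
        unfolding rearrangement_def
      proof (intro Inf_greatest)
        fix z assume "z \<in> {ennreal s |s. 0 < s \<and> distribution_function u (indicator E) s \<le> ennreal t}"
        then obtain s where s: "z = ennreal s" "0 < s" "distribution_function u (indicator E) s \<le> ennreal t" by auto
        then have "1 \<le> s" using True D[of s] by (auto simp: not_less[symmetric])
        then show "1 \<le> z" by (simp add: s(1))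
      qed
    qed
    then show ?thesis using True by simp
  next
    case False
    \<comment> \<open>The infimum runs over s > 0 only, so the value 0 is approached but not
      attained.\<close>
    have "rearrangement u (indicator E) t \<le> 0 + ennreal e" if "0 < e" for e
      using that False D[of e] by (simp add: rearrangement_le not_less)
    then have "rearrangement u (indicator E) t \<le> 0" by (rule ennreal_le_epsilon)
    then show ?thesis using False by simp
  qed
qed

text \<open>A geometric series summed downwards from its largest index, the integer part of log 2
  r.\<close>

lemma nn_integral_dyadic_le:
  assumes "0 \<le> r" "0 < p"
  shows "(\<integral>\<^sup>+ k. ennreal (2 powr (real_of_int k * p)) * indicator {k. 2 powr real_of_int k \<le> r} k
      \<partial>count_space UNIV) \<le> ennreal (1 / (1 - 2 powr - p) * r powr p)"
proof (cases "r = 0")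
  case True
  then have "{k. 2 powr real_of_int k \<le> r} = {}" by (auto simp: not_le)
  then show ?thesis by simp
next
  case False
  then have r: "0 < r" using assms by simp
  define m where "m = \<lfloor>log 2 r\<rfloor>"
  have iff: "2 powr real_of_int k \<le> r \<longleftrightarrow> k \<le> m" for k
    using r by (simp add: m_def le_floor_iff le_log_iff)
  have bij: "bij_betw (\<lambda>j::nat. m - int j) UNIV {..m}"
    by (rule bij_betwI[where g="\<lambda>k. nat (m - k)"]) auto
  define x where "x = 2 powr - p"
  have x: "0 < x" "x < 1" using two_powr_uminus_less_1[OF assms(2)] by (auto simp: x_def)
  have "(\<integral>\<^sup>+ k. ennreal (2 powr (real_of_int k * p)) * indicator {k. 2 powr real_of_int k \<le> r} k \<partial>count_space UNIV)
      = (\<integral>\<^sup>+ k. ennreal (2 powr (real_of_int k * p)) \<partial>count_space {..m})"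
    by (subst nn_integral_count_space_indicator) (auto simp: iff intro!: nn_integral_cong split: split_indicator)
  also have "\<dots> = (\<integral>\<^sup>+ j. ennreal (2 powr (real_of_int (m - int j) * p)) \<partial>count_space UNIV)"
    by (rule nn_integral_bij_count_space[OF bij, symmetric])
  also have "\<dots> = (\<Sum>j. ennreal (2 powr (real_of_int (m - int j) * p)))"
    by (rule nn_integral_count_space_nat)
  also have "(\<lambda>j. 2 powr (real_of_int (m - int j) * p)) = (\<lambda>j. 2 powr (real_of_int m * p) * x ^ j)"
    by (auto simp: x_def powr_powr powr_realpow[symmetric] powr_add[symmetric] algebra_simps)
  then have "(\<Sum>j. ennreal (2 powr (real_of_int (m - int j) * p))) = (\<Sum>j. ennreal (2 powr (real_of_int m * p) * x ^ j))"
    by metis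
  also have "\<dots> = ennreal (2 powr (real_of_int m * p) * (1 / (1 - x)))"
    using x by (intro suminf_ennreal_eq sums_mult geometric_sums) auto
  also have "\<dots> \<le> ennreal (1 / (1 - x) * r powr p)"
  proof (rule ennreal_leI)
    have "2 powr (real_of_int m * p) = (2 powr real_of_int m) powr p" by (simp add: powr_powr)
    also have "\<dots> \<le> r powr p" using iff[of m] assms by (intro powr_mono2) auto
    finally have "2 powr (real_of_int m * p) \<le> r powr p" .
    then have "(1 / (1 - x)) * 2 powr (real_of_int m * p) \<le> (1 / (1 - x)) * r powr p"
      using x by (intro mult_left_mono) auto
    then show "2 powr (real_of_int m * p) * (1 / (1 - x)) \<le> 1 / (1 - x) * r powr p" by (simp add: mult.commute)
  qed
  finally show ?thesis by (simp add: x_def)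
qed

context lorentz_weights
begin

text \<open>The p-th power of the Lorentz norm. Without the root, Tonelli applies directly and
  constants multiply.\<close>

definition lorentz_integral :: "real \<Rightarrow> (real ^ 'n \<Rightarrow> ereal) \<Rightarrow> ennreal" where
  "lorentz_integral p f =
     (\<integral>\<^sup>+ t\<in>{0<..}. ennreal_powr (rearrangement u f t) p * ennreal (w t) \<partial>lebesgue)"

text \<open>Up to constants depending on p, a Riemann sum at dyadic heights for the layer-cake
  integral of p s^(p-1) W(u({|f| > s})) over s > 0. In this form the norm sees f only through
  \<open>\<phi>\<close> of its level sets.\<close>

definition dyadic_sum :: "real \<Rightarrow> (real ^ 'n \<Rightarrow> ereal) \<Rightarrow> ennreal" where
  "dyadic_sum p f = (\<integral>\<^sup>+ k. ennreal (2 powr (real_of_int k * p)) *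
     \<phi> {x. ereal (2 powr real_of_int k) < \<bar>f x\<bar>} \<partial>count_space (UNIV :: int set))"

text \<open>Tonelli: integrating \<open>w\<close> over the points t below D k produces
  \<open>W\<close> at D k.\<close>

lemma nn_integral_below_dyadic:
  assumes "\<And>k. 0 \<le> c k"
  shows "(\<integral>\<^sup>+ t. (\<integral>\<^sup>+ k. ennreal (c k) * indicator {t. ennreal t < D k} t \<partial>count_space (UNIV :: int set)) *
      (ennreal (w t) * indicator {0<..} t) \<partial>lebesgue)
    = (\<integral>\<^sup>+ k. ennreal (c k) * primitive w (D k) \<partial>count_space UNIV)"
proof -
  have "(\<integral>\<^sup>+ t. (\<integral>\<^sup>+ k. ennreal (c k) * indicator {t. ennreal t < D k} t \<partial>count_space (UNIV :: int set)) *
      (ennreal (w t) * indicator {0<..} t) \<partial>lebesgue)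
    = (\<integral>\<^sup>+ t. (\<integral>\<^sup>+ k. ennreal (c k) * ((ennreal (w t) * indicator {0<..} t) * indicator {t. ennreal t < D k} t)
        \<partial>count_space (UNIV :: int set)) \<partial>lebesgue)"
    by (intro nn_integral_cong, subst nn_integral_multc[symmetric]) (auto simp: mult_ac)
  also have "\<dots> = (\<integral>\<^sup>+ k. (\<integral>\<^sup>+ t. ennreal (c k) * ((ennreal (w t) * indicator {0<..} t) * indicator {t. ennreal t < D k} t)
        \<partial>lebesgue) \<partial>count_space (UNIV :: int set))"
    using measurable_w
    by (intro nn_integral_count_space_nn_integral) (auto intro!: borel_measurable_times)
  also have "\<dots> = (\<integral>\<^sup>+ k. ennreal (c k) * primitive w (D k) \<partial>count_space UNIV)"
  proof (rule nn_integral_cong)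
    fix k
    show "(\<integral>\<^sup>+ t. ennreal (c k) * ((ennreal (w t) * indicator {0<..} t) * indicator {t. ennreal t < D k} t) \<partial>lebesgue) =
       ennreal (c k) * primitive w (D k)"
      using measurable_w
      by (subst nn_integral_cmult)
        (auto intro!: borel_measurable_times nn_integral_cong arg_cong[where f="\<lambda>z. ennreal (c k) * z"]
          simp: primitive_def split: split_indicator)
  qed
  finally show ?thesis .
qed

text \<open>Pointwise in t, a single summand suffices: the one whose height 2^k lies just below the
  value of the rearrangement.\<close>

lemma lorentz_integral_le:
  assumes "0 < p"
  shows "lorentz_integral p f \<le> ennreal (2 powr p) * dyadic_sum p f"
proof -
  define D where "D k = distribution_function u f (2 powr real_of_int k)" for k
  define c where "c k = 2 powr p * 2 powr (real_of_int k * p)" for k :: int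
  define S where "S t = (\<integral>\<^sup>+ k. ennreal (c k) * indicator {t. ennreal t < D k} t \<partial>count_space (UNIV :: int set))" for t
  have pt: "ennreal_powr (rearrangement u f t) p \<le> S t" for t
  proof -
    have z: "ennreal (z powr p) \<le> S t" if "0 < z" "ennreal z \<le> rearrangement u f t" for z
    proof -
      \<comment> \<open>The ceiling minus one, not the floor: 2^k has to be strictly below z to
        contradict a rearrangement of at most 2^k.\<close>
      define k where "k = \<lceil>log 2 z\<rceil> - 1"
      have k: "2 powr real_of_int k < z" "z \<le> 2 powr (real_of_int k + 1)"
        using \<open>0 < z\<close> by (auto simp: k_def powr_less_iff le_powr_iff) linarith+
      have "ennreal t < D k"
      proof (rule ccontr)
        assume "\<not> ennreal t < D k"
        then have "rearrangement u f t \<le> ennreal (2 powr real_of_int k)"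
          by (intro rearrangement_le) (auto simp: D_def not_less)
        then have "ennreal z \<le> ennreal (2 powr real_of_int k)" using that(2) by (rule order_trans[rotated])
        then show False using k by (simp add: ennreal_le_iff)
      qed
      have "z powr p \<le> (2 powr (real_of_int k + 1)) powr p"
        using k \<open>0 < z\<close> assms by (intro powr_mono2) auto
      also have "\<dots> = c k" by (simp add: c_def powr_powr powr_add[symmetric] algebra_simps)
      finally have "ennreal (z powr p) \<le> ennreal (c k) * indicator {t. ennreal t < D k} t"
        using \<open>ennreal t < D k\<close> by (simp add: ennreal_leI)
      also have "\<dots> \<le> S t" unfolding S_def by (rule nn_integral_ge_point) simp
      finally show ?thesis .
    qed
    show ?thesis
    proof (cases "rearrangement u f t")
      case (real r)
      then show ?thesis using z[of r] assms by (cases "r = 0") (auto simp: ennreal_powr_ennreal)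
    next
      case top
      \<comment> \<open>Where the rearrangement is infinite, the bound for finite z below it applies
        to every n^(1/p).\<close>
      have "of_nat n \<le> S t" for n
      proof (cases "n = 0")
        case False
        then have "ennreal ((real n powr (1 / p)) powr p) \<le> S t" using top by (intro z) auto
        then show ?thesis using assms False by (simp add: powr_powr ennreal_of_nat_eq_real_of_nat)
      qed simp
      then have "S t = top" by (metis ennreal_Ex_less_of_nat not_less top.not_eq_extremum)
      then show ?thesis by simp
    qed
  qed
  have "lorentz_integral p f \<le> (\<integral>\<^sup>+ t. S t * (ennreal (w t) * indicator {0<..} t) \<partial>lebesgue)"
    unfolding lorentz_integral_def using pt by (intro nn_integral_mono) (simp add: mult.assoc mult_right_mono)
  also have "\<dots> = (\<integral>\<^sup>+ k. ennreal (c k) * primitive w (D k) \<partial>count_space UNIV)"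
    unfolding S_def by (rule nn_integral_below_dyadic) (simp add: c_def)
  also have "\<dots> = ennreal (2 powr p) * dyadic_sum p f"
    unfolding dyadic_sum_def
    by (subst nn_integral_cmult[symmetric])
      (auto simp: c_def D_def \<phi>_def distribution_function_def ennreal_mult mult_ac)
  finally show ?thesis .
qed

text \<open>If t < D k, then the rearrangement at t is at least 2^k. For fixed t the heights that
  contribute therefore form a geometric series controlled by its largest term.\<close>

lemma dyadic_sum_le:
  assumes "0 < p"
  shows "dyadic_sum p f \<le> ennreal (1 / (1 - 2 powr - p)) * lorentz_integral p f"
proof -
  define D where "D k = distribution_function u f (2 powr real_of_int k)" for k
  define C where "C = 1 / (1 - 2 powr - p)"
  have C: "0 < C" using two_powr_uminus_less_1[OF assms] by (simp add: C_def)
  define c where "c k = 1 / C * 2 powr (real_of_int k * p)" for k :: int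
  define S where "S t = (\<integral>\<^sup>+ k. ennreal (c k) * indicator {t. ennreal t < D k} t \<partial>count_space (UNIV :: int set))" for t
  have pt: "S t \<le> ennreal_powr (rearrangement u f t) p" for t
  proof (cases "rearrangement u f t")
    case (real r)
    have "S t \<le> (\<integral>\<^sup>+ k. ennreal (1 / C) * (ennreal (2 powr (real_of_int k * p)) * indicator {k. 2 powr real_of_int k \<le> r} k) \<partial>count_space UNIV)"
      unfolding S_def
    proof (rule nn_integral_mono)
      fix k :: int
      have "(indicator {t. ennreal t < D k} t :: ennreal) \<le> indicator {k. 2 powr real_of_int k \<le> r} k"
        using rearrangement_ge[of t u f "2 powr real_of_int k"] real
        by (auto simp: D_def ennreal_le_iff split: split_indicator)
      then have "ennreal (c k) * indicator {t. ennreal t < D k} t \<le> ennreal (c k) * indicator {k. 2 powr real_of_int k \<le> r} k"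
        by (rule mult_left_mono) simp
      then show "ennreal (c k) * indicator {t. ennreal t < D k} t
          \<le> ennreal (1 / C) * (ennreal (2 powr (real_of_int k * p)) * indicator {k. 2 powr real_of_int k \<le> r} k)"
        using C by (simp only: c_def ennreal_mult'' powr_ge_zero mult.assoc)
    qed
    also have "\<dots> = ennreal (1 / C) * (\<integral>\<^sup>+ k. ennreal (2 powr (real_of_int k * p)) * indicator {k. 2 powr real_of_int k \<le> r} k \<partial>count_space UNIV)"
      by (rule nn_integral_cmult) simp
    also have "\<dots> \<le> ennreal (1 / C) * ennreal (C * r powr p)"
      unfolding C_def by (intro mult_left_mono nn_integral_dyadic_le) (use real assms in auto)
    also have "\<dots> = ennreal (r powr p)" using C by (simp add: ennreal_mult[symmetric])
    finally show ?thesis using real by (simp add: ennreal_powr_ennreal)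
  qed simp
  have "dyadic_sum p f = (\<integral>\<^sup>+ k. ennreal C * (ennreal (c k) * primitive w (D k)) \<partial>count_space UNIV)"
    unfolding dyadic_sum_def
  proof (rule nn_integral_cong)
    fix k :: int
    have "ennreal (2 powr (real_of_int k * p)) = ennreal C * ennreal (c k)"
      using C by (simp add: c_def ennreal_mult[symmetric])
    then show "ennreal (2 powr (real_of_int k * p)) * \<phi> {x. ereal (2 powr real_of_int k) < \<bar>f x\<bar>} =
        ennreal C * (ennreal (c k) * primitive w (D k))"
      by (simp add: D_def \<phi>_def distribution_function_def mult.assoc)
  qed
  also have "\<dots> = ennreal C * (\<integral>\<^sup>+ k. ennreal (c k) * primitive w (D k) \<partial>count_space UNIV)"
    by (rule nn_integral_cmult) simp
  also have "\<dots> = ennreal C * (\<integral>\<^sup>+ t. S t * (ennreal (w t) * indicator {0<..} t) \<partial>lebesgue)"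
    unfolding S_def by (subst nn_integral_below_dyadic) (use C in \<open>auto simp: c_def\<close>)
  also have "\<dots> \<le> ennreal C * lorentz_integral p f"
    unfolding lorentz_integral_def using pt
    by (intro mult_left_mono nn_integral_mono) (simp_all add: mult.assoc mult_right_mono)
  finally show ?thesis by (simp add: C_def)
qed

lemma lorentz_norm_eq: "lorentz_norm u w p f = ennreal_powr (lorentz_integral p f) (1 / p)"
  by (simp add: lorentz_norm_def lorentz_integral_def)

lemma lorentz_norm_le_iff:
  assumes "0 < p" "0 < c"
  shows "lorentz_norm u w p f \<le> ennreal c * lorentz_norm u w p g \<longleftrightarrow>
    lorentz_integral p f \<le> ennreal (c powr p) * lorentz_integral p g"
  using assms by (simp add: lorentz_norm_eq ennreal_powr_le_iff)

lemma lorentz_integral_indicator: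
  assumes "0 < p"
  shows "lorentz_integral p (indicator E) = \<phi> E"
proof -
  have "ennreal_powr (indicator A t) p = indicator A t" for A and t :: real
    using assms by (auto split: split_indicator simp: ennreal_powr_def)
  then show ?thesis
    unfolding lorentz_integral_def rearrangement_indicator \<phi>_def primitive_def
    by (intro nn_integral_cong) (auto split: split_indicator)
qed

lemma lorentz_norm_indicator: "0 < p \<Longrightarrow> lorentz_norm u w p (indicator E) = ennreal_powr (\<phi> E) (1 / p)"
  by (simp add: lorentz_norm_eq lorentz_integral_indicator)

end

section \<open>Self-improvement of the restricted strong type\<close>

lemma ennreal_mult_le_imp_le:
  assumes "0 < c" "ennreal c * a \<le> b"
  shows "a \<le> ennreal (1 / c) * b"
proof -
  have "a = ennreal (1 / c) * (ennreal c * a)"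
    using assms by (simp add: mult.assoc[symmetric] ennreal_mult[symmetric])
  also have "\<dots> \<le> ennreal (1 / c) * b" using assms by (intro mult_left_mono) auto
  finally show ?thesis .
qed

lemma ennreal_mult_mult:
  "0 \<le> a \<Longrightarrow> 0 \<le> b \<Longrightarrow> ennreal a * (ennreal b * x) = ennreal (a * b) * x"
  by (simp add: ennreal_mult mult.assoc)

lemma sum_le_nn_integral_count_space:
  fixes f :: "'i \<Rightarrow> ennreal"
  assumes "finite F"
  shows "sum f F \<le> (\<integral>\<^sup>+ k. f k \<partial>count_space UNIV)"
proof -
  have "sum f F = (\<integral>\<^sup>+ k. f k \<partial>count_space F)" using assms by (simp add: nn_integral_count_space_finite)
  also have "\<dots> = (\<integral>\<^sup>+ k. f k * indicator F k \<partial>count_space UNIV)"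
    by (subst nn_integral_count_space_indicator) auto
  also have "\<dots> \<le> (\<integral>\<^sup>+ k. f k \<partial>count_space UNIV)"
    by (intro nn_integral_mono) (auto split: split_indicator)
  finally show ?thesis .
qed

context lorentz_weights
begin

definition restricted_weak_type :: "real \<Rightarrow> real \<Rightarrow> bool" where
  "restricted_weak_type q C \<longleftrightarrow>
     (\<forall>E \<in> sets lebesgue. \<forall>s>0. \<phi> (Mset E s) \<le> ennreal (C * s powr - q) * \<phi> E)"

text \<open>Each passage from E to a level set multiplies the bound by \<mu>^-q and the height by
  \<mu>, so after any number of steps the product is the right power of the height. Only the last
  step, at a height bounded below, contributes a constant.\<close>

lemma restricted_weak_type_self_improves:
  assumes p: "0 < p" and A: "0 < A"
    and le: "\<And>E. E \<in> sets lebesgue \<Longrightarrow> lorentz_integral p (maximal_function (indicator E)) \<le> ennreal A * \<phi> E"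
  obtains q C where "0 < q" "q < p" "0 < C" "restricted_weak_type q C"
proof -
  define A1 where "A1 = 1 / (1 - 2 powr - p) * A"
  have A1: "0 < A1" using A two_powr_uminus_less_1[OF p] by (simp add: A1_def)
  have dy: "(\<integral>\<^sup>+ k. ennreal (2 powr (real_of_int k * p)) * \<phi> (Mset E (2 powr real_of_int k)) \<partial>count_space UNIV)
      \<le> ennreal A1 * \<phi> E" if E: "E \<in> sets lebesgue" for E
  proof -
    have "(\<integral>\<^sup>+ k. ennreal (2 powr (real_of_int k * p)) * \<phi> (Mset E (2 powr real_of_int k)) \<partial>count_space UNIV)
        = dyadic_sum p (maximal_function (indicator E))"
      by (simp add: dyadic_sum_def maximal_function_indicator)
    also have "\<dots> \<le> ennreal (1 / (1 - 2 powr - p)) * lorentz_integral p (maximal_function (indicator E))"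
      using p by (rule dyadic_sum_le)
    also have "\<dots> \<le> ennreal (1 / (1 - 2 powr - p)) * (ennreal A * \<phi> E)"
      using le[OF E] by (intro mult_left_mono) auto
    also have "\<dots> = ennreal A1 * \<phi> E"
      unfolding A1_def using A two_powr_uminus_less_1[OF p] by (intro ennreal_mult_mult) auto
    finally show ?thesis .
  qed
  define \<kappa> where "\<kappa> = kappa TYPE('n)"
  have \<kappa>: "1 \<le> \<kappa>" unfolding \<kappa>_def by (rule kappa_ge_1)
  \<comment> \<open>Dyadic heights below 2^-m stay at most 1/2 after multiplication by
    \<kappa>.\<close>
  obtain m :: nat where m: "2 * \<kappa> < 2 ^ m" using real_arch_pow[of 2 "2 * \<kappa>"] by auto
  \<comment> \<open>With L consecutive heights, the smallest summand is at most A1 / L times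
    \<phi>(E). This choice of L leaves the factor 1/2 after \<kappa>^p has been paid.\<close>
  obtain L :: nat where L: "2 * \<kappa> powr p * A1 < real L" using reals_Archimedean2 by blast
  have Lpos: "0 < L" using L A1 \<kappa> by (cases L) (auto simp: mult_less_0_iff)
  define N where "N = m + L"
  define \<delta> where "\<delta> = \<kappa> * 2 powr - real N"
  have pick: "\<exists>\<mu>. \<delta> \<le> \<mu> \<and> \<mu> \<le> 1 / 2 \<and> \<phi> (Mset E (\<mu> / \<kappa>)) \<le> ennreal (1 / 2 * \<mu> powr - p) * \<phi> E"
    if E: "E \<in> sets lebesgue" for E
  proof -
    define F where "F = {- int N ..< - int m}"
    define f where "f k = ennreal (2 powr (real_of_int k * p)) * \<phi> (Mset E (2 powr real_of_int k))" for k
    have F: "finite F" "F \<noteq> {}" "card F = L" using Lpos by (auto simp: F_def N_def)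
    then have "Min (f ` F) \<in> f ` F" by (intro Min_in) auto
    then obtain k where k: "k \<in> F" "f k = Min (f ` F)" by auto
    have "of_nat (card F) * f k \<le> sum f F"
      using k F by (intro sum_bounded_below) auto
    also have "\<dots> \<le> ennreal A1 * \<phi> E"
      using sum_le_nn_integral_count_space[OF F(1), of f] dy[OF E] by (auto simp: f_def)
    finally have "ennreal (real L) * (ennreal (2 powr (real_of_int k * p)) * \<phi> (Mset E (2 powr real_of_int k))) \<le> ennreal A1 * \<phi> E"
      by (simp add: F(3) f_def ennreal_of_nat_eq_real_of_nat)
    then have "ennreal (real L * 2 powr (real_of_int k * p)) * \<phi> (Mset E (2 powr real_of_int k)) \<le> ennreal A1 * \<phi> E"
      by (simp add: ennreal_mult mult.assoc)
    then have "\<phi> (Mset E (2 powr real_of_int k)) \<le> ennreal (1 / (real L * 2 powr (real_of_int k * p))) * (ennreal A1 * \<phi> E)"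
      using Lpos by (intro ennreal_mult_le_imp_le) auto
    also have "\<dots> = ennreal (1 / (real L * 2 powr (real_of_int k * p)) * A1) * \<phi> E"
      using A1 by (intro ennreal_mult_mult) auto
    also have "\<dots> \<le> ennreal (1 / 2 * (\<kappa> * 2 powr real_of_int k) powr - p) * \<phi> E"
    proof (intro mult_right_mono ennreal_leI)
      have "(\<kappa> * 2 powr real_of_int k) powr - p = 1 / (\<kappa> powr p * 2 powr (real_of_int k * p))"
        using \<kappa> by (simp add: powr_minus powr_mult powr_powr divide_inverse)
      moreover have "1 / (real L * 2 powr (real_of_int k * p)) * A1 \<le> 1 / 2 * (1 / (\<kappa> powr p * 2 powr (real_of_int k * p)))"
        using L Lpos \<kappa> by (simp add: field_simps)
      ultimately show "1 / (real L * 2 powr (real_of_int k * p)) * A1 \<le> 1 / 2 * (\<kappa> * 2 powr real_of_int k) powr - p"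
        by simp
    qed simp
    finally have "\<phi> (Mset E (\<kappa> * 2 powr real_of_int k / \<kappa>)) \<le> ennreal (1 / 2 * (\<kappa> * 2 powr real_of_int k) powr - p) * \<phi> E"
      using \<kappa> by simp
    moreover have "\<delta> \<le> \<kappa> * 2 powr real_of_int k"
      using k(1) \<kappa> unfolding \<delta>_def by (intro mult_left_mono powr_mono) (auto simp: F_def)
    moreover have "\<kappa> * 2 powr real_of_int k \<le> 1 / 2"
    proof -
      have "\<kappa> * 2 powr real_of_int k \<le> \<kappa> * 2 powr - real m"
        using k(1) \<kappa> by (intro mult_left_mono powr_mono) (auto simp: F_def)
      also have "\<dots> = \<kappa> / 2 ^ m" by (simp add: powr_minus powr_realpow divide_inverse)
      also have "\<dots> \<le> 1 / 2" using m by (simp add: field_simps)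
      finally show ?thesis .
    qed
    ultimately show ?thesis by blast
  qed
  \<comment> \<open>The upper bound follows from \<open>pick\<close> for any set, since it places
    some \<mu> between \<delta> and 1/2; the empty set serves.\<close>
  have \<delta>: "0 < \<delta>" "\<delta> \<le> 1 / 2" using \<kappa> pick[of "{}"] by (auto simp: \<delta>_def)
  \<comment> \<open>The second entry makes \<delta>^\<eta> at least 1/2, so the gained factor 1/2
    can be exchanged for \<mu>^\<eta>. The first keeps p - \<eta> positive.\<close>
  define \<eta> where "\<eta> = min (p / 2) (log \<delta> (1 / 2))"
  have "0 < log \<delta> (1 / 2)" using \<delta> by (simp add: log_def divide_neg_neg)
  then have \<eta>: "0 < \<eta>" "\<eta> < p" using p by (auto simp: \<eta>_def)
  have "\<delta> powr log \<delta> (1 / 2) \<le> \<delta> powr \<eta>"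
    using \<delta> by (intro powr_mono') (auto simp: \<eta>_def)
  then have \<delta>\<eta>: "1 / 2 \<le> \<delta> powr \<eta>" using \<delta> by simp
  define q where "q = p - \<eta>"
  have q: "0 < q" "q < p" using \<eta> by (auto simp: q_def)
  have gain: "\<exists>\<mu>. \<delta> \<le> \<mu> \<and> \<mu> \<le> 1 / 2 \<and> \<phi> (Mset E (\<mu> / \<kappa>)) \<le> ennreal (\<mu> powr - q) * \<phi> E"
    if E: "E \<in> sets lebesgue" for E
  proof -
    obtain \<mu> where \<mu>: "\<delta> \<le> \<mu>" "\<mu> \<le> 1 / 2" "\<phi> (Mset E (\<mu> / \<kappa>)) \<le> ennreal (1 / 2 * \<mu> powr - p) * \<phi> E"
      using pick[OF E] by auto
    have "1 / 2 \<le> \<mu> powr \<eta>" using \<delta>\<eta> \<mu>(1) \<delta> \<eta> powr_mono2[of \<eta> \<delta> \<mu>] by linarith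
    then have "1 / 2 * \<mu> powr - p \<le> \<mu> powr \<eta> * \<mu> powr - p" by (intro mult_right_mono) auto
    also have "\<dots> = \<mu> powr - q" by (simp add: q_def powr_add[symmetric])
    finally have "ennreal (1 / 2 * \<mu> powr - p) * \<phi> E \<le> ennreal (\<mu> powr - q) * \<phi> E"
      by (intro mult_right_mono ennreal_leI) auto
    with \<mu> show ?thesis by (meson order_trans)
  qed
  \<comment> \<open>The bound given by the single summand at height 2^-N, which lies below \<delta>.
    It serves all heights in [\<delta>, 1).\<close>
  define K where "K = A1 * 2 powr (real N * p)"
  have K: "0 < K" using A1 by (simp add: K_def)
  \<comment> \<open>The induction is on the number of halvings that lead down to t. The set E has to
    be arbitrary, because the step applies the hypothesis to a level set of E.\<close>
  have "\<phi> (Mset E t) \<le> ennreal (K * t powr - q) * \<phi> E"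
    if "E \<in> sets lebesgue" "2 powr - real j \<le> t" for j E t
    using that
  proof (induction j arbitrary: E t)
    case 0
    then show ?case by (simp add: Mset_empty_of_ge_1)
  next
    case (Suc j)
    note E = Suc.prems(1)
    have t: "0 < t" by (rule less_le_trans[OF _ Suc.prems(2)]) simp
    consider "1 \<le> t" | "\<delta> \<le> t" "t < 1" | "t < \<delta>" by linarith
    then show ?case
    proof cases
      case 1
      then show ?thesis using E by (simp add: Mset_empty_of_ge_1)
    next
      case 2
      have "2 powr - real N \<le> \<delta>" using \<kappa> by (simp add: \<delta>_def)
      then have "2 powr - real N \<le> t" using 2(1) by linarith
      then have "Mset E t \<subseteq> Mset E (2 powr real_of_int (- int N))" by (intro superlevel_mono) auto
      then have "\<phi> (Mset E t) \<le> \<phi> (Mset E (2 powr real_of_int (- int N)))" by (rule phi_mono)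
      also have "\<dots> \<le> ennreal (1 / 2 powr (real_of_int (- int N) * p)) * (ennreal A1 * \<phi> E)"
      proof (rule ennreal_mult_le_imp_le)
        have "ennreal (2 powr (real_of_int (- int N) * p)) * \<phi> (Mset E (2 powr real_of_int (- int N))) \<le>
           (\<integral>\<^sup>+ k. ennreal (2 powr (real_of_int k * p)) * \<phi> (Mset E (2 powr real_of_int k)) \<partial>count_space UNIV)"
          by (rule nn_integral_ge_point) simp
        then show "ennreal (2 powr (real_of_int (- int N) * p)) * \<phi> (Mset E (2 powr real_of_int (- int N))) \<le> ennreal A1 * \<phi> E"
          using dy[OF E] by (rule order_trans)
      qed simp
      also have "\<dots> = ennreal K * \<phi> E"
        using A1 by (simp add: K_def ennreal_mult mult_ac powr_minus divide_inverse)
      also have "\<dots> \<le> ennreal (K * t powr - q) * \<phi> E"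
      proof (intro mult_right_mono ennreal_leI)
        have "1 \<le> t powr - q" using 2 t q powr_mono'[of "-q" 0 t] by simp
        then show "K \<le> K * t powr - q" using K by simp
      qed simp
      finally show ?thesis .
    next
      case 3
      obtain \<mu> where \<mu>: "\<delta> \<le> \<mu>" "\<mu> \<le> 1 / 2" "\<phi> (Mset E (\<mu> / \<kappa>)) \<le> ennreal (\<mu> powr - q) * \<phi> E"
        using gain[OF E] by auto
      have \<mu>0: "0 < \<mu>" using \<mu> \<delta> by linarith
      \<comment> \<open>The new height t / \<mu> is below 1 because t < \<delta> \<le> \<mu>, as the
        inclusion demands, and at least 2 t because \<mu> \<le> 1/2, which uses up one induction
        step.\<close>
      have "Mset E (\<kappa> * (\<mu> / \<kappa>) * (t / \<mu>)) \<subseteq> Mset (Mset E (\<mu> / \<kappa>)) (t / \<mu>)"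
        unfolding \<kappa>_def
        by (rule Mset_subset_Mset_Mset[OF E]) (use \<mu> \<mu>0 \<kappa> t 3 in \<open>auto simp: \<kappa>_def[symmetric] field_simps\<close>)
      then have "\<phi> (Mset E t) \<le> \<phi> (Mset (Mset E (\<mu> / \<kappa>)) (t / \<mu>))"
        using \<kappa> \<mu>0 by (intro phi_mono) simp
      also have "\<dots> \<le> ennreal (K * (t / \<mu>) powr - q) * \<phi> (Mset E (\<mu> / \<kappa>))"
      proof (rule Suc.IH)
        show "Mset E (\<mu> / \<kappa>) \<in> sets lebesgue" using \<mu>0 \<kappa> by simp
        have "2 powr - real j = 2 * 2 powr - real (Suc j)" by (simp add: powr_diff powr_minus inverse_eq_divide)
        also have "\<dots> \<le> 2 * t" using Suc.prems(2) by simp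
        also have "\<dots> \<le> t / \<mu>" using \<mu> \<mu>0 t by (simp add: field_simps)
        finally show "2 powr - real j \<le> t / \<mu>" .
      qed
      also have "\<dots> \<le> ennreal (K * (t / \<mu>) powr - q) * (ennreal (\<mu> powr - q) * \<phi> E)"
        using \<mu>(3) by (intro mult_left_mono) auto
      also have "\<dots> = ennreal (K * ((t / \<mu>) powr - q * \<mu> powr - q)) * \<phi> E"
        using K by (simp add: ennreal_mult mult.assoc)
      also have "(t / \<mu>) powr - q * \<mu> powr - q = t powr - q"
        using t \<mu>0 by (simp add: powr_mult[symmetric])
      finally show ?thesis .
    qed
  qed
  note iter = this
  have "restricted_weak_type q K"
    unfolding restricted_weak_type_def
  proof (intro ballI allI impI)
    fix E :: "(real ^ 'n) set" and s :: real
    assume E: "E \<in> sets lebesgue" and s: "0 < s"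
    obtain j where "(1 / 2) ^ j < s" using real_arch_pow_inv[OF s, of "1 / 2"] by auto
    then have "2 powr - real j \<le> s" by (simp add: powr_minus powr_realpow power_one_over inverse_eq_divide)
    with E show "\<phi> (Mset E s) \<le> ennreal (K * s powr - q) * \<phi> E" by (rule iter)
  qed
  then show ?thesis using that q K by blast
qed

end

section \<open>Doubling of the primitive\<close>

context lorentz_weights
begin

text \<open>An intermediate value argument for centred cubes: their measure grows from 0 to the
  total mass and depends continuously on the side, since the faces are null sets. The measure of the
  cube at the supremum \<open>L\<close> is bounded above from inside and below from outside.\<close>

lemma obtain_cube_of_measure:
  assumes t: "0 < t" "ennreal t < weight_measure u UNIV"
  obtains Q where "cube Q" "emeasure \<mu> Q = ennreal t"
proof -
  define B :: "real \<Rightarrow> (real ^ 'n) set" where "B l = cbox (\<chi> i. - l) (\<chi> i. l)" for l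
  have B: "B l \<in> sets \<mu>" for l by (simp add: B_def)
  have mono: "B l \<subseteq> B l'" if "l \<le> l'" for l l'
    unfolding B_def
  proof
    fix x :: "real ^ 'n" assume "x \<in> cbox (\<chi> i. - l) (\<chi> i. l)"
    then have "- l \<le> x $ i \<and> x $ i \<le> l" for i by (simp add: mem_box_cart)
    then have "- l' \<le> x $ i \<and> x $ i \<le> l'" for i using that by (smt (verit))
    then show "x \<in> cbox (\<chi> i. - l') (\<chi> i. l')" by (simp add: mem_box_cart)
  qed
  have mono_mu: "emeasure \<mu> (B l) \<le> emeasure \<mu> (B l')" if "l \<le> l'" for l l'
    using mono[OF that] B by (rule emeasure_mono)
  have finB: "emeasure \<mu> (B l) < top" for l
    using weight_measure_compact[of "B l"] by (simp add: B_def weight_measure_eq)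
  define S where "S = {l. 0 \<le> l \<and> emeasure \<mu> (B l) \<le> ennreal t}"
  have B0: "emeasure \<mu> (B 0) = 0"
  proof -
    have "B 0 = {0}" by (auto simp: B_def mem_box_cart vec_eq_iff intro: antisym)
    moreover have "{0 :: real ^ 'n} \<in> null_sets lebesgue" by (simp add: negligible_iff_null_sets[symmetric])
    ultimately show ?thesis by (metis mu_null)
  qed
  then have S0: "0 \<in> S" by (simp add: S_def)
  obtain n :: nat where n: "ennreal t < emeasure \<mu> (B (real n))"
  proof -
    have "(\<Union>n. B (real n)) = UNIV"
    proof (intro equalityI subset_UNIV subsetI)
      fix x :: "real ^ 'n"
      obtain n where n: "norm x \<le> real n" using real_arch_simple by blast
      have "\<bar>x $ i\<bar> \<le> real n" for i
        using component_le_norm_cart[of x i] n by simp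
      then have "- real n \<le> x $ i \<and> x $ i \<le> real n" for i by (smt (verit))
      then have "x \<in> B (real n)" by (simp add: B_def mem_box_cart)
      then show "x \<in> (\<Union>n. B (real n))" by blast
    qed
    moreover have "emeasure \<mu> (\<Union>n. B (real n)) = (SUP n. emeasure \<mu> (B (real n)))"
      using mono B by (intro SUP_emeasure_incseq[symmetric]) (auto simp: incseq_def)
    ultimately have "ennreal t < (SUP n. emeasure \<mu> (B (real n)))"
      using t(2) by (simp add: weight_measure_eq)
    then show ?thesis using that by (auto simp: less_SUP_iff)
  qed
  have bdd: "l \<le> real n" if "l \<in> S" for l
  proof (rule ccontr)
    assume "\<not> l \<le> real n"
    then have "emeasure \<mu> (B (real n)) \<le> emeasure \<mu> (B l)" by (intro mono_mu) simp
    then show False using n that by (auto simp: S_def not_less[symmetric] dest: less_le_trans order_trans)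
  qed
  then have bddS: "bdd_above S" by (auto simp: bdd_above_def)
  define L where "L = Sup S"
  have L0: "0 \<le> L" unfolding L_def by (rule cSup_upper[OF S0 bddS])
  have below: "emeasure \<mu> (B l) \<le> ennreal t" if "l < L" for l
  proof -
    have "S \<noteq> {}" using S0 by auto
    then have "\<exists>l'\<in>S. l < l'" using less_cSup_iff[OF _ bddS, of l] that by (simp add: L_def)
    then obtain l' where "l' \<in> S" "l < l'" by blast
    then show ?thesis using mono_mu[of l l'] by (auto simp: S_def)
  qed
  have above: "ennreal t \<le> emeasure \<mu> (B l)" if "L < l" for l
  proof (rule ccontr)
    assume "\<not> ?thesis"
    then have "l \<in> S" using that L0 by (simp add: S_def)
    then have "l \<le> L" unfolding L_def using bddS by (rule cSup_upper)
    then show False using that by simp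
  qed
  \<comment> \<open>Increasing cubes exhaust only the open cube; the faces are added afterwards as a
    null set.\<close>
  have "emeasure \<mu> (box (\<chi> i. - L) (\<chi> i. L)) \<le> ennreal t"
  proof -
    have "box (\<chi> i. - L) (\<chi> i. L) \<subseteq> (\<Union>k. B (L - 1 / real (Suc k)))"
    proof
      fix x :: "real ^ 'n" assume x: "x \<in> box (\<chi> i. - L) (\<chi> i. L)"
      define e where "e = Min (range (\<lambda>i. L - \<bar>x $ i\<bar>))"
      have "L - \<bar>x $ i\<bar> > 0" for i using x by (auto simp: mem_box_cart abs_less_iff minus_less_iff)
      then have "0 < e" by (auto simp: e_def)
      then obtain k where k: "1 / real (Suc k) < e" using nat_approx_posE by metis
      have "\<bar>x $ i\<bar> \<le> L - 1 / real (Suc k)" for i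
      proof -
        have "e \<le> L - \<bar>x $ i\<bar>" unfolding e_def by (intro Min_le) auto
        then show ?thesis using k by linarith
      qed
      then have "- (L - 1 / real (Suc k)) \<le> x $ i \<and> x $ i \<le> L - 1 / real (Suc k)" for i by (smt (verit))
      then have "x \<in> B (L - 1 / real (Suc k))" by (simp add: B_def mem_box_cart)
      then show "x \<in> (\<Union>k. B (L - 1 / real (Suc k)))" by blast
    qed
    then have "emeasure \<mu> (box (\<chi> i. - L) (\<chi> i. L)) \<le> emeasure \<mu> (\<Union>k. B (L - 1 / real (Suc k)))"
      using B by (intro emeasure_mono) auto
    also have "\<dots> = (SUP k. emeasure \<mu> (B (L - 1 / real (Suc k))))"
    proof (rule SUP_emeasure_incseq[symmetric])
      show "incseq (\<lambda>k. B (L - 1 / real (Suc k)))"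
        unfolding incseq_def by (intro allI impI mono diff_left_mono frac_le) auto
    qed (use B in auto)
    also have "\<dots> \<le> ennreal t" by (intro SUP_least below) simp
    finally show ?thesis .
  qed
  moreover have "emeasure \<mu> (B L) = emeasure \<mu> (box (\<chi> i. - L) (\<chi> i. L))"
  proof -
    have "B L - box (\<chi> i. - L) (\<chi> i. L) \<in> null_sets lebesgue"
      unfolding B_def using negligible_frontier_interval by (simp only: negligible_iff_null_sets)
    then have "emeasure \<mu> (B L - box (\<chi> i. - L) (\<chi> i. L)) = 0" by (rule mu_null)
    moreover have "emeasure \<mu> (B L) = emeasure \<mu> (B L - box (\<chi> i. - L) (\<chi> i. L)) + emeasure \<mu> (box (\<chi> i. - L) (\<chi> i. L))"
      using box_subset_cbox[of "\<chi> i. - L" "\<chi> i. L"] B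
      by (subst plus_emeasure) (auto simp: B_def intro!: arg_cong[where f="emeasure \<mu>"])
    ultimately show ?thesis by simp
  qed
  moreover have "ennreal t \<le> emeasure \<mu> (B L)"
  proof -
    have "B L = (\<Inter>k. B (L + 1 / real (Suc k)))"
    proof (intro equalityI subsetI INT_I)
      fix x k assume "x \<in> B L"
      then show "x \<in> B (L + 1 / real (Suc k))" using mono[of L "L + 1 / real (Suc k)"] by auto
    next
      fix x assume x: "x \<in> (\<Inter>k. B (L + 1 / real (Suc k)))"
      have "\<bar>x $ i\<bar> \<le> L" for i
      proof (rule field_le_epsilon)
        fix e :: real assume "0 < e"
        then obtain k where k: "1 / real (Suc k) < e" using nat_approx_posE by metis
        have "x \<in> B (L + 1 / real (Suc k))" using x by blast
        then have "- (L + 1 / real (Suc k)) \<le> x $ i \<and> x $ i \<le> L + 1 / real (Suc k)"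
          by (simp only: B_def mem_box_cart vec_lambda_beta)
        then show "\<bar>x $ i\<bar> \<le> L + e" using k by linarith
      qed
      then have "- L \<le> x $ i \<and> x $ i \<le> L" for i by (smt (verit))
      then show "x \<in> B L" by (simp add: B_def mem_box_cart)
    qed
    then have "emeasure \<mu> (B L) = (INF k. emeasure \<mu> (B (L + 1 / real (Suc k))))"
    proof (simp only:, intro INF_emeasure_decseq[symmetric])
      show "decseq (\<lambda>k. B (L + 1 / real (Suc k)))"
        unfolding decseq_def by (intro allI impI mono add_left_mono frac_le) auto
    qed (use B finB in \<open>auto simp: less_top[symmetric]\<close>)
    also have "ennreal t \<le> \<dots>" by (intro INF_greatest above) simp
    finally show ?thesis .
  qed
  ultimately have eq: "emeasure \<mu> (B L) = ennreal t" by simp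
  have "L \<noteq> 0" using eq B0 t(1) by auto
  moreover have "B L = cbox (\<chi> i. - L) ((\<chi> i. - L) + (\<chi> i. 2 * L))"
    by (simp add: B_def plus_vec_def)
  ultimately have "cube (B L)" using L0 cube_cbox[of "2 * L" "\<chi> i. - L"] by simp
  then show ?thesis using eq by (rule that)
qed

text \<open>The lighter of two opposite corner cubes has density 3^-n in Q, so Q lies in one of its
  level sets, while its measure is at most t / 2.\<close>

lemma phi_cube_le_half:
  assumes weak: "restricted_weak_type q C" and C: "0 < C" and Q: "cube Q" "emeasure \<mu> Q = ennreal t" and t: "0 \<le> t"
  shows "\<phi> Q \<le> ennreal (C * ((1 / 3) ^ CARD('n) / 2) powr - q) * primitive w (ennreal (t / 2))"
proof -
  obtain a l where l: "0 < l" and Qeq: "Q = cbox a (a + (\<chi> i. l))" using Q(1) by (auto simp: cube_def)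
  define b where "b = a + (\<chi> i. 2 * l / 3)"
  define E1 where "E1 = cbox a (a + (\<chi> i. l / 3))"
  define E2 where "E2 = cbox b (b + (\<chi> i. l / 3))"
  have cubes: "cube E1" "cube E2" using l by (auto simp: E1_def E2_def)
  have sub: "E1 \<subseteq> Q" "E2 \<subseteq> Q"
  proof -
    have third: "0 < l / 3" "2 * l / 3 = 2 * (l / 3)" "l = 3 * (l / 3)" using l by auto
    show "E1 \<subseteq> Q"
    proof
      fix x assume "x \<in> E1"
      then have "a $ i \<le> x $ i \<and> x $ i \<le> a $ i + l / 3" for i by (simp add: E1_def mem_cube)
      then show "x \<in> Q" unfolding Qeq mem_cube using third by (smt (verit))
    qed
    show "E2 \<subseteq> Q"
    proof
      fix x assume "x \<in> E2"
      then have "a $ i + 2 * l / 3 \<le> x $ i \<and> x $ i \<le> a $ i + 2 * l / 3 + l / 3" for i by (simp add: E2_def b_def mem_cube)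
      then have "a $ i \<le> x $ i \<and> x $ i \<le> a $ i + l" for i using third by (smt (verit))
      then show "x \<in> Q" unfolding Qeq mem_cube by simp
    qed
  qed
  have disj: "E1 \<inter> E2 = {}"
  proof (rule ccontr)
    assume "E1 \<inter> E2 \<noteq> {}"
    then obtain x where "x \<in> E1" "x \<in> E2" by auto
    then have "\<forall>i. x $ i \<le> a $ i + l / 3" "\<forall>i. a $ i + 2 * l / 3 \<le> x $ i"
      unfolding E1_def E2_def b_def mem_cube by simp_all
    then have "a $ i + 2 * l / 3 \<le> a $ i + l / 3" for i using order_trans by blast
    then have "2 * l / 3 \<le> l / 3" by simp
    then show False using l by simp
  qed
  obtain E where E: "cube E" "E \<subseteq> Q" "emeasure \<mu> E \<le> ennreal (t / 2)"
    "emeasure lebesgue E = ennreal ((l / 3) ^ CARD('n))"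
  proof -
    have "emeasure \<mu> E1 + emeasure \<mu> E2 \<le> emeasure \<mu> Q"
      using cubes Q(1) sub disj by (subst plus_emeasure) (auto intro!: emeasure_mono simp: sets_cube)
    then have "\<not> (ennreal (t / 2) < emeasure \<mu> E1 \<and> ennreal (t / 2) < emeasure \<mu> E2)"
      using add_strict_mono[of "ennreal (t / 2)" "emeasure \<mu> E1" "ennreal (t / 2)" "emeasure \<mu> E2"] t
      by (auto simp: Q(2) ennreal_plus[symmetric] simp del: ennreal_plus)
    moreover have "emeasure lebesgue E1 = ennreal ((l / 3) ^ CARD('n))" "emeasure lebesgue E2 = ennreal ((l / 3) ^ CARD('n))"
      unfolding E1_def E2_def using l by (simp_all only: emeasure_cube divide_pos_pos zero_less_numeral)
    ultimately show ?thesis using that cubes sub by (meson not_less)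
  qed
  \<comment> \<open>Half the density of the small cube, since membership in a level set requires a
    strict inequality.\<close>
  define s :: real where "s = (1 / 3) ^ CARD('n) / 2"
  have s: "0 < s" by (simp add: s_def)
  have "Q \<subseteq> Mset E s"
  proof
    fix x assume "x \<in> Q"
    have "ennreal s * emeasure lebesgue Q = ennreal (s * l ^ CARD('n))"
      using s l by (simp only: Qeq emeasure_cube ennreal_mult less_imp_le zero_le_power)
    also have "\<dots> < ennreal ((l / 3) ^ CARD('n))"
      using l by (intro ennreal_lessI) (auto simp: s_def power_divide divide_strict_left_mono)
    also have "\<dots> = emeasure lebesgue (E \<inter> Q)" using E by (simp add: Int_absorb2)
    finally show "x \<in> Mset E s" using \<open>x \<in> Q\<close> Q(1) sets_cube[OF E(1)] by (auto simp: Mset_eq)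
  qed
  then have "\<phi> Q \<le> \<phi> (Mset E s)" by (rule phi_mono)
  also have "\<dots> \<le> ennreal (C * s powr - q) * \<phi> E"
    using weak s sets_cube[OF E(1)] by (simp add: restricted_weak_type_def)
  also have "\<phi> E \<le> primitive w (ennreal (t / 2))"
    using E sets_cube[OF E(1)] by (simp add: phi_eq primitive_mono)
  finally show ?thesis by (simp add: s_def mult_left_mono)
qed

lemma primitive_doubling:
  assumes weak: "restricted_weak_type q C" and C: "0 < C"
  obtains D where "1 \<le> D" "\<And>t. primitive w (2 * t) \<le> ennreal D * primitive w t"
proof -
  define D where "D = max 1 (C * ((1 / 3) ^ CARD('n) / 2) powr - q)"
  have half: "primitive w (ennreal r) \<le> ennreal D * primitive w (ennreal (r / 2))"
    if r: "0 < r" "ennreal r < weight_measure u UNIV" for r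
  proof -
    obtain Q where Q: "cube Q" "emeasure \<mu> Q = ennreal r" using obtain_cube_of_measure[OF r] .
    have "primitive w (ennreal r) = \<phi> Q" using Q sets_cube[OF Q(1)] by (simp add: phi_eq)
    also have "\<dots> \<le> ennreal (C * ((1 / 3) ^ CARD('n) / 2) powr - q) * primitive w (ennreal (r / 2))"
      using weak C Q r by (intro phi_cube_le_half) auto
    also have "\<dots> \<le> ennreal D * primitive w (ennreal (r / 2))"
      by (intro mult_right_mono ennreal_leI) (auto simp: D_def)
    finally show ?thesis .
  qed
  have "primitive w (2 * t) \<le> ennreal D * primitive w t" for t
  proof (cases t)
    case (real r)
    \<comment> \<open>Only values below the total mass are measures of cubes; beyond it
      \<open>W\<close> does not grow any more.\<close>
    define T where "T = min (2 * t) (weight_measure u UNIV)"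
    have "primitive w (2 * t) \<le> primitive w T"
      using primitive_le_UNIV[of "2 * t"] by (auto simp: T_def min_def)
    also have "\<dots> \<le> ennreal D * primitive w t"
    proof (rule primitive_le_by_left_continuity)
      fix s assume s: "0 < s" "ennreal s < T"
      then have "ennreal s < 2 * ennreal r" by (simp add: T_def real)
      also have "\<dots> = ennreal (2 * r)" using real by (simp add: ennreal_mult)
      finally have "s / 2 \<le> r" using s by (simp add: ennreal_less_iff)
      have "primitive w (ennreal s) \<le> ennreal D * primitive w (ennreal (s / 2))"
        using s by (intro half) (auto simp: T_def)
      also have "\<dots> \<le> ennreal D * primitive w t"
        unfolding real using \<open>s / 2 \<le> r\<close> by (intro mult_left_mono primitive_mono ennreal_leI) auto
      finally show "primitive w (ennreal s) \<le> ennreal D * primitive w t" .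
    qed
    finally show ?thesis .
  next
    case top
    have "1 * primitive w top \<le> ennreal D * primitive w top"
      by (intro mult_right_mono) (auto simp: D_def)
    then show ?thesis by (simp add: top ennreal_mult_top)
  qed
  then show ?thesis using that[of D] by (auto simp: D_def)
qed

section \<open>Consequences of doubling\<close>

lemma primitive_power_doubling:
  assumes "1 \<le> D" "\<And>t. primitive w (2 * t) \<le> ennreal D * primitive w t"
  shows "primitive w (ennreal (2 ^ n) * t) \<le> ennreal (D ^ n) * primitive w t"
proof (induction n)
  case (Suc n)
  have "primitive w (ennreal (2 ^ Suc n) * t) = primitive w (2 * (ennreal (2 ^ n) * t))"
    by (simp add: ennreal_mult mult.assoc)
  also have "\<dots> \<le> ennreal D * primitive w (ennreal (2 ^ n) * t)" by (rule assms)
  also have "\<dots> \<le> ennreal D * (ennreal (D ^ n) * primitive w t)"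
    using Suc by (intro mult_left_mono) auto
  also have "\<dots> = ennreal (D ^ Suc n) * primitive w t"
    using assms(1) by (simp add: ennreal_mult_mult)
  finally show ?case .
qed simp

text \<open>Doubling is iterated about log 2 c times. Rounding up costs one further factor D, and
  D^(log 2 c) = c^(log 2 D).\<close>

lemma primitive_scale:
  assumes D: "1 \<le> D" "\<And>t. primitive w (2 * t) \<le> ennreal D * primitive w t" and c: "1 \<le> c"
  shows "primitive w (ennreal c * t) \<le> ennreal (D * c powr log 2 D) * primitive w t"
proof -
  define n where "n = nat \<lceil>log 2 c\<rceil>"
  have l0: "0 \<le> log 2 c" using c by simp
  have n: "log 2 c \<le> real n" "real n \<le> log 2 c + 1" using l0 by (auto simp: n_def)
  have "c = 2 powr log 2 c" using c by simp
  also have "\<dots> \<le> 2 powr real n" using n by (intro powr_mono) auto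
  finally have "c \<le> 2 ^ n" by (simp add: powr_realpow)
  then have "primitive w (ennreal c * t) \<le> primitive w (ennreal (2 ^ n) * t)"
    by (intro primitive_mono mult_right_mono ennreal_leI) auto
  also have "\<dots> \<le> ennreal (D ^ n) * primitive w t" using D by (rule primitive_power_doubling)
  also have "\<dots> \<le> ennreal (D * c powr log 2 D) * primitive w t"
  proof (intro mult_right_mono ennreal_leI)
    have "D ^ n = D powr real n" using D by (simp add: powr_realpow)
    also have "\<dots> \<le> D powr (log 2 c + 1)" using n D by (intro powr_mono) auto
    also have "\<dots> = D * D powr log 2 c" using D by (simp add: powr_add)
    also have "D powr log 2 c = c powr log 2 D"
      using D c by (simp add: powr_def log_def)
    finally show "D ^ n \<le> D * c powr log 2 D" .
  qed simp
  finally show ?thesis .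
qed

text \<open>A zero of \<open>W\<close> at a positive point would spread by doubling to all finite
  points and by left continuity to infinity.\<close>

lemma primitive_pos:
  assumes D: "1 \<le> D" "\<And>t. primitive w (2 * t) \<le> ennreal D * primitive w t" and t: "0 < t"
  shows "0 < primitive w t"
proof (rule ccontr)
  assume "\<not> ?thesis"
  then have 0: "primitive w t = 0" by (simp add: not_less)
  then have "t \<noteq> top" using primitive_top_pos by auto
  then obtain r where r: "t = ennreal r" "0 < r" using t by (cases t) auto
  have "primitive w top \<le> 0"
  proof (rule primitive_le_by_left_continuity)
    fix s :: real assume s: "0 < s"
    obtain n where "s / r < 2 ^ n" using real_arch_pow[of 2 "s / r"] by auto
    then have "ennreal s \<le> ennreal (2 ^ n) * t"
      using r s by (simp add: ennreal_mult[symmetric] field_simps ennreal_leI)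
    then have "primitive w (ennreal s) \<le> primitive w (ennreal (2 ^ n) * t)" by (rule primitive_mono)
    also have "\<dots> \<le> ennreal (D ^ n) * primitive w t" using D by (rule primitive_power_doubling)
    finally show "primitive w (ennreal s) \<le> 0" by (simp add: 0)
  qed
  then show False using primitive_top_pos by simp
qed

text \<open>The numbers (1 - \<rho>) \<rho>^j s add up to s. If s is below the sum of the t j, some
  t j is therefore at least its share, and one summand on the right already dominates W(s).
  Monotonicity of \<open>W\<close> takes the place of subadditivity.\<close>

lemma primitive_suminf_le:
  assumes \<rho>: "0 < \<rho>" "\<rho> < 1"
  shows "primitive w (\<Sum>j. t j) \<le> (\<Sum>j. primitive w (ennreal (1 / ((1 - \<rho>) * \<rho> ^ j)) * t j))"
proof (rule primitive_le_by_left_continuity)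
  fix s :: real assume s: "0 < s" "ennreal s < (\<Sum>j. t j)"
  have "\<exists>j. ennreal ((1 - \<rho>) * \<rho> ^ j * s) \<le> t j"
  proof (rule ccontr)
    assume "\<not> ?thesis"
    then have "(\<Sum>j. t j) \<le> (\<Sum>j. ennreal ((1 - \<rho>) * \<rho> ^ j * s))"
      by (intro suminf_le) (auto simp: not_le less_imp_le)
    also have "\<dots> = ennreal ((1 - \<rho>) * (1 / (1 - \<rho>)) * s)"
      using \<rho> s by (intro suminf_ennreal_eq sums_mult2 sums_mult geometric_sums) auto
    also have "\<dots> = ennreal s" using \<rho> by simp
    finally show False using s by simp
  qed
  then obtain j where "ennreal ((1 - \<rho>) * \<rho> ^ j * s) \<le> t j" by auto
  then have "ennreal ((1 - \<rho>) * \<rho> ^ j) * ennreal s \<le> t j" using \<rho> s by (simp add: ennreal_mult)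
  then have "ennreal s \<le> ennreal (1 / ((1 - \<rho>) * \<rho> ^ j)) * t j"
    using \<rho> by (intro ennreal_mult_le_imp_le) auto
  then have "primitive w (ennreal s) \<le> primitive w (ennreal (1 / ((1 - \<rho>) * \<rho> ^ j)) * t j)"
    by (rule primitive_mono)
  also have "\<dots> = (\<Sum>j\<in>{j}. primitive w (ennreal (1 / ((1 - \<rho>) * \<rho> ^ j)) * t j))" by simp
  also have "\<dots> \<le> (\<Sum>j. primitive w (ennreal (1 / ((1 - \<rho>) * \<rho> ^ j)) * t j))"
    by (intro sum_le_suminf) auto
  finally show "primitive w (ennreal s) \<le> (\<Sum>j. primitive w (ennreal (1 / ((1 - \<rho>) * \<rho> ^ j)) * t j))" .
qed

end

section \<open>Interpolation\<close>

text \<open>With n the least index outside J, the right side is at least a + a + 2 a + ... + 2^(n-1)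
  a = 2^n a. If there is no such n, it is infinite. In the application J consists of the j with a
  2^j < z.\<close>

lemma suminf_ge_dyadic:
  fixes z :: ennreal
  assumes a: "0 < a" and off: "\<And>j. j \<notin> J \<Longrightarrow> z \<le> ennreal (a * 2 ^ j)"
  shows "z \<le> ennreal a + (\<Sum>j. ennreal (a * 2 ^ j) * indicator J j)"
proof -
  have part: "ennreal (a * 2 ^ n) \<le> ennreal a + (\<Sum>j. ennreal (a * 2 ^ j) * indicator J j)"
    if "\<And>j. j < n \<Longrightarrow> j \<in> J" for n
  proof -
    have "a + (\<Sum>j<n. a * 2 ^ j) = a * 2 ^ n" by (induction n) (auto simp: algebra_simps)
    then have "ennreal (a * 2 ^ n) = ennreal (a + (\<Sum>j<n. a * 2 ^ j))" by simp
    also have "\<dots> = ennreal a + (\<Sum>j<n. ennreal (a * 2 ^ j))"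
      using a by (subst ennreal_plus) (auto simp: sum_nonneg)
    also have "(\<Sum>j<n. ennreal (a * 2 ^ j)) = (\<Sum>j<n. ennreal (a * 2 ^ j) * indicator J j)"
      using that by (intro sum.cong) auto
    also have "\<dots> \<le> (\<Sum>j. ennreal (a * 2 ^ j) * indicator J j)" by (intro sum_le_suminf) auto
    finally show ?thesis by simp
  qed
  show ?thesis
  proof (cases "\<exists>j. j \<notin> J")
    case True
    define n where "n = (LEAST j. j \<notin> J)"
    have "n \<notin> J" unfolding n_def using True by (rule LeastI_ex)
    moreover have "j \<in> J" if "j < n" for j using not_less_Least that by (auto simp: n_def)
    ultimately show ?thesis using off part by (meson order_trans)
  next
    case False
    have "of_nat m \<le> ennreal a + (\<Sum>j. ennreal (a * 2 ^ j) * indicator J j)" for m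
    proof -
      obtain n where "real m / a < 2 ^ n" using real_arch_pow[of 2 "real m / a"] by auto
      then have "real m \<le> a * 2 ^ n" using a by (simp add: field_simps)
      then have "of_nat m \<le> ennreal (a * 2 ^ n)" by (simp add: ennreal_of_nat_eq_real_of_nat ennreal_leI)
      also have "\<dots> \<le> ennreal a + (\<Sum>j. ennreal (a * 2 ^ j) * indicator J j)" using False by (intro part) auto
      finally show ?thesis .
    qed
    then have "ennreal a + (\<Sum>j. ennreal (a * 2 ^ j) * indicator J j) = top"
      by (metis ennreal_Ex_less_of_nat not_less top.not_eq_extremum)
    then show ?thesis by simp
  qed
qed

text \<open>The densities (1 - \<rho>) (\<rho> / 2)^j are chosen so that the heights a 2^j turn them
  into a (1 - \<rho>) \<rho>^j, which sum to a. If no level set exceeds its density in Q, the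
  average of g over Q is at most a + a.\<close>

lemma superlevel_subset_UN_Mset:
  fixes g :: "real ^ 'n \<Rightarrow> ennreal"
  assumes [measurable]: "g \<in> borel_measurable lebesgue" and a: "0 < a" and \<rho>: "0 < \<rho>" "\<rho> < 1"
  shows "superlevel g (2 * a) \<subseteq> (\<Union>j. Mset {y. ennreal (a * 2 ^ j) < g y} ((1 - \<rho>) * (\<rho> / 2) ^ j))"
proof
  fix x assume "x \<in> superlevel g (2 * a)"
  then obtain Q where Q: "cube Q" "x \<in> Q" "ennreal (2 * a) * emeasure lebesgue Q < (\<integral>\<^sup>+ y\<in>Q. g y \<partial>lebesgue)"
    by (auto simp: superlevel_def)
  have Qs[measurable]: "Q \<in> sets lebesgue" using Q(1) by (rule sets_cube)
  define F where "F j = {y. ennreal (a * 2 ^ j) < g y}" for j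
  have F[measurable]: "F j \<in> sets lebesgue" for j
  proof -
    have "{y \<in> space lebesgue. ennreal (a * 2 ^ j) < g y} \<in> sets lebesgue" by measurable
    then show ?thesis by (simp add: F_def)
  qed
  show "x \<in> (\<Union>j. Mset {y. ennreal (a * 2 ^ j) < g y} ((1 - \<rho>) * (\<rho> / 2) ^ j))"
  proof (rule ccontr)
    assume no: "\<not> ?thesis"
    have small: "emeasure lebesgue (F j \<inter> Q) \<le> ennreal ((1 - \<rho>) * (\<rho> / 2) ^ j) * emeasure lebesgue Q" for j
      using no F Q by (intro emeasure_le_of_notin_Mset[of "F j" Q x]) (auto simp: F_def)
    have "(\<integral>\<^sup>+ y\<in>Q. g y \<partial>lebesgue) \<le>
       (\<integral>\<^sup>+ y. (ennreal a + (\<Sum>j. ennreal (a * 2 ^ j) * indicator (F j) y)) * indicator Q y \<partial>lebesgue)"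
    proof (intro nn_integral_mono mult_right_mono)
      fix y
      have "g y \<le> ennreal a + (\<Sum>j. ennreal (a * 2 ^ j) * indicator {j. y \<in> F j} j)"
        using a by (rule suminf_ge_dyadic) (auto simp: F_def not_less)
      then show "g y \<le> ennreal a + (\<Sum>j. ennreal (a * 2 ^ j) * indicator (F j) y)"
        by (simp add: indicator_def)
    qed simp
    also have "\<dots> = (\<integral>\<^sup>+ y. ennreal a * indicator Q y + (\<Sum>j. ennreal (a * 2 ^ j) * indicator (F j \<inter> Q) y) \<partial>lebesgue)"
    proof (rule nn_integral_cong)
      fix y
      show "(ennreal a + (\<Sum>j. ennreal (a * 2 ^ j) * indicator (F j) y)) * indicator Q y =
          ennreal a * indicator Q y + (\<Sum>j. ennreal (a * 2 ^ j) * indicator (F j \<inter> Q) y)"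
        by (cases "y \<in> Q") (simp_all add: indicator_inter_arith)
    qed
    also have "\<dots> = ennreal a * emeasure lebesgue Q + (\<integral>\<^sup>+ y. (\<Sum>j. ennreal (a * 2 ^ j) * indicator (F j \<inter> Q) y) \<partial>lebesgue)"
      by (subst nn_integral_add) (auto simp: nn_integral_cmult_indicator)
    also have "(\<integral>\<^sup>+ y. (\<Sum>j. ennreal (a * 2 ^ j) * indicator (F j \<inter> Q) y) \<partial>lebesgue) =
        (\<Sum>j. ennreal (a * 2 ^ j) * emeasure lebesgue (F j \<inter> Q))"
      by (subst nn_integral_suminf) (auto simp: nn_integral_cmult_indicator)
    also have "\<dots> \<le> (\<Sum>j. ennreal (a * 2 ^ j) * (ennreal ((1 - \<rho>) * (\<rho> / 2) ^ j) * emeasure lebesgue Q))"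
      using small by (intro suminf_le mult_left_mono) auto
    also have "\<dots> = (\<Sum>j. ennreal (a * ((1 - \<rho>) * \<rho> ^ j)) * emeasure lebesgue Q)"
    proof (intro suminf_cong)
      fix j
      have "ennreal (a * 2 ^ j) * (ennreal ((1 - \<rho>) * (\<rho> / 2) ^ j) * emeasure lebesgue Q) =
         ennreal (a * 2 ^ j * ((1 - \<rho>) * (\<rho> / 2) ^ j)) * emeasure lebesgue Q"
        using a \<rho> by (intro ennreal_mult_mult) auto
      also have "a * 2 ^ j * ((1 - \<rho>) * (\<rho> / 2) ^ j) = a * ((1 - \<rho>) * \<rho> ^ j)"
        by (simp add: power_divide)
      finally show "ennreal (a * 2 ^ j) * (ennreal ((1 - \<rho>) * (\<rho> / 2) ^ j) * emeasure lebesgue Q) =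
         ennreal (a * ((1 - \<rho>) * \<rho> ^ j)) * emeasure lebesgue Q" .
    qed
    also have "\<dots> = (\<Sum>j. ennreal (a * ((1 - \<rho>) * \<rho> ^ j))) * emeasure lebesgue Q" by simp
    also have "(\<Sum>j. ennreal (a * ((1 - \<rho>) * \<rho> ^ j))) = ennreal (a * ((1 - \<rho>) * (1 / (1 - \<rho>))))"
      using a \<rho> by (intro suminf_ennreal_eq sums_mult geometric_sums) auto
    also have "\<dots> = ennreal a" using \<rho> by simp
    also have "ennreal a * emeasure lebesgue Q + ennreal a * emeasure lebesgue Q = ennreal (2 * a) * emeasure lebesgue Q"
      using a by (simp add: distrib_right[symmetric] ennreal_plus[symmetric] del: ennreal_plus)
    finally show False using Q(3) by simp
  qed
qed

context lorentz_weights
begin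

lemma emeasure_mu_UN_le:
  "(\<And>j::nat. A j \<in> sets lebesgue) \<Longrightarrow> emeasure \<mu> (\<Union>j. A j) \<le> (\<Sum>j. emeasure \<mu> (A j))"
  by (intro emeasure_subadditive_countably) auto

text \<open>Substitute for countable subadditivity: the j-th set costs a constant times \<rho>^(-j
  log 2 D), a growth that is as slow as desired when \<rho> is close to 1.\<close>

lemma phi_UN_le_suminf:
  assumes A: "\<And>j::nat. A j \<in> sets lebesgue" and \<rho>: "0 < \<rho>" "\<rho> < 1"
    and D: "1 \<le> D" "\<And>t. primitive w (2 * t) \<le> ennreal D * primitive w t"
  shows "\<phi> (\<Union>j. A j) \<le> (\<Sum>j. ennreal (D * (1 / ((1 - \<rho>) * \<rho> ^ j)) powr log 2 D) * \<phi> (A j))"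
proof -
  have "\<phi> (\<Union>j. A j) = primitive w (emeasure \<mu> (\<Union>j. A j))" using A by (intro phi_eq) auto
  also have "\<dots> \<le> primitive w (\<Sum>j. emeasure \<mu> (A j))" using A by (intro primitive_mono emeasure_mu_UN_le)
  also have "\<dots> \<le> (\<Sum>j. primitive w (ennreal (1 / ((1 - \<rho>) * \<rho> ^ j)) * emeasure \<mu> (A j)))"
    using \<rho> by (rule primitive_suminf_le)
  also have "\<dots> \<le> (\<Sum>j. ennreal (D * (1 / ((1 - \<rho>) * \<rho> ^ j)) powr log 2 D) * \<phi> (A j))"
  proof (intro suminf_le allI)
    fix j
    have "(1 - \<rho>) * \<rho> ^ j \<le> 1 * 1" using \<rho> by (intro mult_mono power_le_one) auto
    then have "1 \<le> 1 / ((1 - \<rho>) * \<rho> ^ j)" using \<rho> by simp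
    then show "primitive w (ennreal (1 / ((1 - \<rho>) * \<rho> ^ j)) * emeasure \<mu> (A j)) \<le>
        ennreal (D * (1 / ((1 - \<rho>) * \<rho> ^ j)) powr log 2 D) * \<phi> (A j)"
      unfolding phi_eq[OF A] using D by (intro primitive_scale)
  qed auto
  finally show ?thesis .
qed

text \<open>The factor 2^(-j p) released by the change of index is the only source of decay in j,
  and it has to outweigh all other losses.\<close>

lemma dyadic_sum_shift:
  "(\<integral>\<^sup>+ k. ennreal (2 powr (real_of_int k * p)) * a (k - 1 + int j) \<partial>count_space (UNIV :: int set))
    = ennreal (2 powr ((1 - real j) * p)) * (\<integral>\<^sup>+ k. ennreal (2 powr (real_of_int k * p)) * a k \<partial>count_space UNIV)"
proof -
  have bij: "bij_betw (\<lambda>k. k - 1 + int j) UNIV UNIV"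
    by (rule bij_betwI[where g="\<lambda>k. k + 1 - int j"]) auto
  have "(\<integral>\<^sup>+ k. ennreal (2 powr (real_of_int k * p)) * a (k - 1 + int j) \<partial>count_space (UNIV :: int set))
    = (\<integral>\<^sup>+ k. ennreal (2 powr ((1 - real j) * p)) * (ennreal (2 powr (real_of_int (k - 1 + int j) * p)) * a (k - 1 + int j)) \<partial>count_space UNIV)"
  proof (rule nn_integral_cong)
    fix k
    have "2 powr ((1 - real j) * p) * 2 powr (real_of_int (k - 1 + int j) * p) = 2 powr (real_of_int k * p)"
      by (simp add: powr_add[symmetric] algebra_simps)
    then show "ennreal (2 powr (real_of_int k * p)) * a (k - 1 + int j) =
        ennreal (2 powr ((1 - real j) * p)) * (ennreal (2 powr (real_of_int (k - 1 + int j) * p)) * a (k - 1 + int j))"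
      by (simp add: ennreal_mult_mult)
  qed
  also have "\<dots> = (\<integral>\<^sup>+ k. ennreal (2 powr ((1 - real j) * p)) * (ennreal (2 powr (real_of_int k * p)) * a k) \<partial>count_space UNIV)"
    by (rule nn_integral_bij_count_space[OF bij,
        where f="\<lambda>k. ennreal (2 powr ((1 - real j) * p)) * (ennreal (2 powr (real_of_int k * p)) * a k)"])
  finally show ?thesis by (simp add: nn_integral_cmult)
qed

lemma lorentz_integral_maximal_function_le:
  assumes weak: "restricted_weak_type q C" and q: "0 < q" "q < p" and C: "0 < C"
  obtains K where "0 < K" "\<And>f. f \<in> borel_measurable lebesgue \<Longrightarrow>
    lorentz_integral p (maximal_function f) \<le> ennreal K * lorentz_integral p f"
proof -
  obtain D where D: "1 \<le> D" "\<And>t. primitive w (2 * t) \<le> ennreal D * primitive w t"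
    using primitive_doubling[OF weak C] by blast
  define \<alpha> where "\<alpha> = log 2 D"
  have \<alpha>: "0 \<le> \<alpha>" using D by (simp add: \<alpha>_def)
  \<comment> \<open>The powers of \<rho> = 2^-\<theta> lost to near subadditivity and to the level
    densities amount to 2^(\<theta> (\<alpha> + q) j). This \<theta> lets them consume exactly half
    of the available exponent p - q.\<close>
  define \<theta> where "\<theta> = (p - q) / (2 * (\<alpha> + q))"
  have \<theta>: "0 < \<theta>" "\<theta> * (\<alpha> + q) = (p - q) / 2" using q \<alpha> by (auto simp: \<theta>_def field_simps)
  define \<rho> :: real where "\<rho> = 2 powr - \<theta>"
  have \<rho>: "0 < \<rho>" "\<rho> < 1" using two_powr_uminus_less_1[OF \<theta>(1)] by (auto simp: \<rho>_def)
  have \<rho>j: "\<rho> ^ j = 2 powr (- \<theta> * real j)" for j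
    by (simp add: \<rho>_def powr_powr powr_realpow[symmetric])
  define s where "s j = (1 - \<rho>) * (\<rho> / 2) ^ j" for j
  define d where "d j = D * (1 / ((1 - \<rho>) * \<rho> ^ j)) powr \<alpha> * (C * s j powr - q)" for j
  have s: "0 < s j" for j using \<rho> by (simp add: s_def)
  have d: "0 \<le> d j" for j using D C by (simp add: d_def)
  define B where "B = D * C * (1 - \<rho>) powr - (\<alpha> + q) * 2 powr p"
  define x :: real where "x = 2 powr - ((p - q) / 2)"
  have x: "0 < x" "x < 1" using two_powr_uminus_less_1[of "(p - q) / 2"] q by (auto simp: x_def)
  have B: "0 < B" using D C \<rho> by (simp add: B_def)
  \<comment> \<open>Balance of exponents: near subadditivity costs \<theta> \<alpha> j, the weak
    type estimate (\<theta> + 1) q j, and the shift returns (j - 1) p. What remains is p - j (p - q)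
    / 2, a convergent geometric series.\<close>
  have dB: "d j * 2 powr ((1 - real j) * p) = B * x ^ j" for j
  proof -
    have sj: "s j = (1 - \<rho>) * 2 powr (- (\<theta> + 1) * real j)"
    proof -
      have "- \<theta> * real j - real j = - (\<theta> + 1) * real j" by (simp add: algebra_simps)
      then show ?thesis
        by (simp only: s_def power_divide \<rho>j powr_diff[symmetric] powr_realpow[symmetric] zero_less_numeral)
    qed
    have "(1 / ((1 - \<rho>) * \<rho> ^ j)) powr \<alpha> = ((1 - \<rho>) * 2 powr (- \<theta> * real j)) powr - \<alpha>"
      unfolding \<rho>j using \<rho> by (simp add: powr_divide powr_minus_divide)
    also have "\<dots> = (1 - \<rho>) powr - \<alpha> * 2 powr (\<theta> * \<alpha> * real j)"
      using \<rho> by (simp add: powr_mult powr_powr mult_ac)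
    finally have 1: "(1 / ((1 - \<rho>) * \<rho> ^ j)) powr \<alpha> = (1 - \<rho>) powr - \<alpha> * 2 powr (\<theta> * \<alpha> * real j)" .
    have 2: "s j powr - q = (1 - \<rho>) powr - q * 2 powr ((\<theta> + 1) * q * real j)"
    proof -
      have "- (\<theta> + 1) * real j * - q = (\<theta> + 1) * q * real j" by (simp add: algebra_simps)
      then show ?thesis unfolding sj using \<rho> by (simp only: powr_mult powr_powr)
    qed
    have 3: "(1 - \<rho>) powr - (\<alpha> + q) = (1 - \<rho>) powr - \<alpha> * (1 - \<rho>) powr - q"
      by (simp add: powr_add[symmetric])
    have "\<theta> * \<alpha> * real j + (\<theta> + 1) * q * real j + (1 - real j) * p = p + (\<theta> * (\<alpha> + q) + q - p) * real j"
      by (simp add: algebra_simps)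
    also have "\<dots> = p + - ((p - q) / 2) * real j" unfolding \<theta>(2) by (simp add: field_simps)
    finally have "2 powr (\<theta> * \<alpha> * real j) * 2 powr ((\<theta> + 1) * q * real j) * 2 powr ((1 - real j) * p)
        = 2 powr p * x ^ j"
      by (simp only: powr_add[symmetric] x_def powr_realpow[symmetric] powr_gt_zero powr_powr)
    then show ?thesis unfolding d_def 1 2 B_def 3 by (simp add: mult_ac)
  qed
  define K0 where "K0 = B * (1 / (1 - x))"
  have K0: "0 < K0" using B x by (simp add: K0_def)
  have dy: "dyadic_sum p (maximal_function f) \<le> ennreal K0 * dyadic_sum p f"
    if f[measurable]: "f \<in> borel_measurable lebesgue" for f
  proof -
    define g where "g y = e2ennreal \<bar>f y\<bar>" for y
    have g[measurable]: "g \<in> borel_measurable lebesgue" unfolding g_def by measurable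
    define a where "a k = \<phi> {y. ereal (2 powr real_of_int k) < \<bar>f y\<bar>}" for k
    have gf: "{y. ennreal r < g y} = {y. ereal r < \<bar>f y\<bar>}" if "0 \<le> r" for r
    proof -
      have "ennreal r < e2ennreal z \<longleftrightarrow> ereal r < z" if "0 \<le> z" for z
        using that \<open>0 \<le> r\<close> by (cases z) (auto simp: ennreal_less_iff)
      then show ?thesis by (auto simp: g_def)
    qed
    have level: "{y. ennreal r < g y} \<in> sets lebesgue" for r
    proof -
      have "{y \<in> space lebesgue. ennreal r < g y} \<in> sets lebesgue" by measurable
      then show ?thesis by simp
    qed
    \<comment> \<open>The inclusion of level sets is used with a = 2^(k-1), so its j-th set is the
      dyadic level k - 1 + j of f.\<close>
    have lev: "\<phi> {y. ereal (2 powr real_of_int k) < \<bar>maximal_function f y\<bar>} \<le> (\<Sum>j. ennreal (d j) * a (k - 1 + int j))" for k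
    proof -
      define F where "F j = {y. ereal (2 powr real_of_int (k - 1 + int j)) < \<bar>f y\<bar>}" for j
      have Fg: "F j = {y. ennreal (2 powr (real_of_int k - 1) * 2 ^ j) < g y}" for j
      proof -
        have "real_of_int (k - 1 + int j) = (real_of_int k - 1) + real j" by simp
        then have "2 powr real_of_int (k - 1 + int j) = 2 powr (real_of_int k - 1) * 2 ^ j"
          by (simp only: powr_add powr_realpow zero_less_numeral)
        then show ?thesis unfolding F_def by (subst gf) simp_all
      qed
      have F: "F j \<in> sets lebesgue" for j
        unfolding Fg by (rule level)
      have M: "Mset (F j) (s j) \<in> sets lebesgue" for j using s[of j] by simp
      have "{y. ereal (2 powr real_of_int k) < \<bar>maximal_function f y\<bar>} = superlevel g (2 * 2 powr (real_of_int k - 1))"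
        by (simp add: maximal_function_superlevel g_def[abs_def] powr_diff)
      also have "\<dots> \<subseteq> (\<Union>j. Mset (F j) (s j))"
        unfolding Fg s_def using g \<rho> by (intro superlevel_subset_UN_Mset) auto
      finally have "\<phi> {y. ereal (2 powr real_of_int k) < \<bar>maximal_function f y\<bar>} \<le> \<phi> (\<Union>j. Mset (F j) (s j))"
        by (rule phi_mono)
      also have "\<dots> \<le> (\<Sum>j. ennreal (D * (1 / ((1 - \<rho>) * \<rho> ^ j)) powr \<alpha>) * \<phi> (Mset (F j) (s j)))"
        unfolding \<alpha>_def using M \<rho> D by (rule phi_UN_le_suminf)
      also have "\<dots> \<le> (\<Sum>j. ennreal (D * (1 / ((1 - \<rho>) * \<rho> ^ j)) powr \<alpha>) * (ennreal (C * s j powr - q) * \<phi> (F j)))"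
        using weak F s by (intro suminf_le mult_left_mono) (auto simp: restricted_weak_type_def)
      also have "\<dots> = (\<Sum>j. ennreal (d j) * a (k - 1 + int j))"
        using D C by (intro suminf_cong) (simp add: ennreal_mult_mult d_def a_def F_def)
      finally show ?thesis .
    qed
    have "dyadic_sum p (maximal_function f) \<le>
        (\<integral>\<^sup>+ k. ennreal (2 powr (real_of_int k * p)) * (\<Sum>j. ennreal (d j) * a (k - 1 + int j)) \<partial>count_space UNIV)"
      unfolding dyadic_sum_def using lev by (intro nn_integral_mono mult_left_mono) auto
    also have "\<dots> = (\<integral>\<^sup>+ k. (\<Sum>j. ennreal (d j) * (ennreal (2 powr (real_of_int k * p)) * a (k - 1 + int j))) \<partial>count_space UNIV)"
      by (simp add: ennreal_suminf_cmult[symmetric] mult_ac)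
    also have "\<dots> = (\<Sum>j. \<integral>\<^sup>+ k. ennreal (d j) * (ennreal (2 powr (real_of_int k * p)) * a (k - 1 + int j)) \<partial>count_space UNIV)"
      by (rule nn_integral_suminf) simp
    also have "\<dots> = (\<Sum>j. ennreal (d j) * (ennreal (2 powr ((1 - real j) * p)) * dyadic_sum p f))"
    proof -
      have "dyadic_sum p f = (\<integral>\<^sup>+ k. ennreal (2 powr (real_of_int k * p)) * a k \<partial>count_space UNIV)"
        by (simp add: dyadic_sum_def a_def)
      then show ?thesis
        by (subst nn_integral_cmult) (simp_all only: dyadic_sum_shift[of p a] borel_measurable_count_space)
    qed
    also have "\<dots> = (\<Sum>j. ennreal (B * x ^ j) * dyadic_sum p f)"
      using d by (simp add: ennreal_mult_mult dB)
    also have "\<dots> = (\<Sum>j. ennreal (B * x ^ j)) * dyadic_sum p f" by simp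
    also have "(\<Sum>j. ennreal (B * x ^ j)) = ennreal K0"
      unfolding K0_def using B x by (intro suminf_ennreal_eq sums_mult geometric_sums) auto
    finally show ?thesis .
  qed
  have p: "0 < p" using q by simp
  define c where "c = 1 / (1 - 2 powr - p)"
  have c: "0 < c" using two_powr_uminus_less_1[OF p] by (simp add: c_def)
  have "lorentz_integral p (maximal_function f) \<le> ennreal (2 powr p * K0 * c) * lorentz_integral p f"
    if f: "f \<in> borel_measurable lebesgue" for f
  proof -
    have "lorentz_integral p (maximal_function f) \<le> ennreal (2 powr p) * dyadic_sum p (maximal_function f)"
      using p by (rule lorentz_integral_le)
    also have "\<dots> \<le> ennreal (2 powr p) * (ennreal K0 * (ennreal c * lorentz_integral p f))"
      using dy[OF f] dyadic_sum_le[OF p, of f] unfolding c_def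
      by (intro mult_left_mono order_trans[OF dy[OF f]]) auto
    also have "\<dots> = ennreal (2 powr p * K0 * c) * lorentz_integral p f"
      using K0 c by (simp add: ennreal_mult mult.assoc)
    finally show ?thesis .
  qed
  then show ?thesis using that[of "2 powr p * K0 * c"] K0 c by simp
qed

end

section \<open>The equivalences\<close>

lemma ennreal_le_real_bound:
  assumes "C < (top :: ennreal)"
  obtains c where "0 < c" "C \<le> ennreal c"
proof -
  have "C \<le> ennreal (max 1 (enn2real C))" using assms by (cases C) (auto intro: ennreal_leI)
  then show ?thesis using that[of "max 1 (enn2real C)"] by simp
qed

text \<open>The conventions agree with this: for b = 0 a finite quotient forces a = 0, and for b =
  \<infinity> the right side is infinite because c is positive.\<close>

lemma le_mult_of_divide_le_ennreal:
  fixes a b :: ennreal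
  assumes "a / b \<le> ennreal c" "0 < c"
  shows "a \<le> ennreal c * b"
proof (cases "b = 0 \<or> b = top")
  case True
  then show ?thesis using assms by (auto simp: ennreal_mult_top top_unique split: if_splits)
next
  case False
  then show ?thesis using assms less_divide_iff_ennreal[of b "ennreal c" a] by (auto simp: not_less[symmetric])
qed

lemma divide_le_of_le_mult_ennreal:
  fixes a b c :: ennreal
  assumes "a \<le> c * b"
  shows "a / b \<le> c"
proof (cases "b = 0 \<or> b = top")
  case True
  then show ?thesis using assms by auto
next
  case False
  then show ?thesis using assms less_divide_iff_ennreal[of b c a] by (auto simp: not_less[symmetric])
qed

context lorentz_weights
begin

definition self_improving_weak_type :: "real \<Rightarrow> bool" where
  "self_improving_weak_type p \<longleftrightarrow> (\<exists>q C. 0 < q \<and> q < p \<and> 0 < C \<and> restricted_weak_type q C)"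

text \<open>By left continuity it suffices to bound W(t) for t below the measure of the level set,
  and for such t the rearrangement of the maximal function is at least s.\<close>

lemma restricted_weak_typeI:
  assumes "\<And>E s t. E \<in> sets lebesgue \<Longrightarrow> 0 < s \<Longrightarrow> 0 < t \<Longrightarrow>
      ennreal s \<le> rearrangement u (maximal_function (indicator E)) t \<Longrightarrow>
      primitive w (ennreal t) \<le> ennreal (C * s powr - q) * \<phi> E"
  shows "restricted_weak_type q C"
  unfolding restricted_weak_type_def
proof (intro ballI allI impI)
  fix E :: "(real ^ 'n) set" and s :: real
  assume E: "E \<in> sets lebesgue" "0 < s"
  show "\<phi> (Mset E s) \<le> ennreal (C * s powr - q) * \<phi> E"
    unfolding \<phi>_def[of "Mset E s"]
  proof (rule primitive_le_by_left_continuity)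
    fix t assume "0 < t" "ennreal t < weight_measure u (Mset E s)"
    moreover from this have "ennreal t < distribution_function u (maximal_function (indicator E)) s"
      using E by (simp add: distribution_function_def maximal_function_indicator)
    ultimately show "primitive w (ennreal t) \<le> ennreal (C * s powr - q) * \<phi> E"
      using E by (intro assms rearrangement_ge)
  qed
qed

lemma rearrangement_maximal_function_le_1:
  assumes "E \<in> sets lebesgue"
  shows "rearrangement u (maximal_function (indicator E)) t \<le> 1"
proof -
  have "distribution_function u (maximal_function (indicator E)) 1 = 0"
    using Mset_empty_of_ge_1[OF assms, of 1] maximal_function_indicator[of 1 E]
    by (simp add: distribution_function_def weight_measure_def)
  then show ?thesis using rearrangement_le[of 1 u "maximal_function (indicator E)" t] by simp
qed

text \<open>If the rearrangement equals r at t, the distribution function exceeds t at heights below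
  r, but possibly not at r itself. The height r / 2 is safe and costs a constant factor.\<close>

lemma primitive_le_of_rearrangement:
  assumes weak: "restricted_weak_type q C" and E: "E \<in> sets lebesgue"
    and r: "rearrangement u (maximal_function (indicator E)) t = ennreal r" "0 < r"
  shows "primitive w (ennreal t) \<le> ennreal (C * (r / 2) powr - q) * \<phi> E"
proof -
  have "ennreal t < distribution_function u (maximal_function (indicator E)) (r / 2)"
  proof (rule ccontr)
    assume "\<not> ?thesis"
    then have "ennreal r \<le> ennreal (r / 2)"
      unfolding r(1)[symmetric] using r(2) by (intro rearrangement_le) (auto simp: not_less)
    then show False using r(2) by (simp add: ennreal_le_iff)
  qed
  then have "primitive w (ennreal t) \<le> \<phi> (Mset E (r / 2))"
    unfolding \<phi>_def using r(2)
    by (intro primitive_mono) (simp add: distribution_function_def maximal_function_indicator)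
  also have "\<dots> \<le> ennreal (C * (r / 2) powr - q) * \<phi> E"
    using weak E r(2) by (simp add: restricted_weak_type_def)
  finally show ?thesis .
qed

lemma self_improving_weak_typeI:
  assumes p: "0 < p" and C: "C < top"
    and le: "\<And>E. E \<in> sets lebesgue \<Longrightarrow>
      lorentz_norm u w p (maximal_function (indicator E)) \<le> C * lorentz_norm u w p (indicator E)"
  shows "self_improving_weak_type p"
proof -
  obtain c where c: "0 < c" "C \<le> ennreal c" using ennreal_le_real_bound[OF C] .
  have "lorentz_integral p (maximal_function (indicator E)) \<le> ennreal (c powr p) * \<phi> E"
    if E: "E \<in> sets lebesgue" for E
  proof -
    have "lorentz_norm u w p (maximal_function (indicator E)) \<le> ennreal c * lorentz_norm u w p (indicator E)"
      using le[OF E] c(2) by (meson mult_right_mono order_trans zero_le)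
    then show ?thesis using p c by (simp add: lorentz_norm_le_iff lorentz_integral_indicator)
  qed
  moreover have "0 < c powr p" using c by simp
  ultimately obtain q C' where "0 < q" "q < p" "0 < C'" "restricted_weak_type q C'"
    using restricted_weak_type_self_improves[OF p, of "c powr p"] by metis
  then show ?thesis unfolding self_improving_weak_type_def by blast
qed

lemma bounded_operator_indicator:
  assumes p: "0 < p" and bdd: "bounded_operator maximal_function (lorentz_norm u w p) (lorentz_norm u w p)"
  obtains C where "C < top" "\<And>E. E \<in> sets lebesgue \<Longrightarrow>
      lorentz_norm u w p (maximal_function (indicator E)) \<le> C * lorentz_norm u w p (indicator E)"
proof -
  obtain C where C: "C < top" "\<And>f. f \<in> borel_measurable lebesgue \<Longrightarrow> lorentz_norm u w p f < top \<Longrightarrow>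
      lorentz_norm u w p (maximal_function f) \<le> C * lorentz_norm u w p f"
    using bdd by (auto simp: bounded_operator_def)
  \<comment> \<open>Boundedness says nothing about indicators of infinite norm. For these the
    inequality is trivial provided the constant is not 0, since 0 times \<infinity> is 0; hence the
    maximum with 1.\<close>
  have "lorentz_norm u w p (maximal_function (indicator E)) \<le> max C 1 * lorentz_norm u w p (indicator E)"
    if E: "E \<in> sets lebesgue" for E
  proof (cases "lorentz_norm u w p (indicator E) < top")
    case True
    have "(indicator E :: real ^ 'n \<Rightarrow> ereal) \<in> borel_measurable lebesgue" using E by simp
    then have "lorentz_norm u w p (maximal_function (indicator E)) \<le> C * lorentz_norm u w p (indicator E)"
      using True by (rule C(2))
    also have "\<dots> \<le> max C 1 * lorentz_norm u w p (indicator E)" by (intro mult_right_mono) auto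
    finally show ?thesis .
  next
    case False
    then have top: "lorentz_norm u w p (indicator E) = top" by (simp add: less_top[symmetric])
    have "max C 1 \<noteq> 0" by (metis max.cobounded2 not_one_le_zero)
    then show ?thesis unfolding top by (simp add: ennreal_mult_top)
  qed
  moreover have "max C 1 < top" using C(1) by simp
  ultimately show ?thesis using that by blast
qed

lemma bounded_operator_of_restricted_weak_type:
  assumes "restricted_weak_type q C" "0 < q" "q < p" "0 < C"
  shows "bounded_operator maximal_function (lorentz_norm u w p) (lorentz_norm u w p)"
proof -
  obtain K where K: "0 < K" "\<And>f. f \<in> borel_measurable lebesgue \<Longrightarrow>
      lorentz_integral p (maximal_function f) \<le> ennreal K * lorentz_integral p f"
    using lorentz_integral_maximal_function_le[OF assms] by blast
  have "lorentz_norm u w p (maximal_function f) \<le> ennreal (K powr (1 / p)) * lorentz_norm u w p f"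
    if "f \<in> borel_measurable lebesgue" for f
    using assms K that by (subst lorentz_norm_le_iff) (simp_all add: powr_powr)
  then show ?thesis unfolding bounded_operator_def by (intro exI[of _ "ennreal (K powr (1 / p))"]) auto
qed

lemma weak_lorentz_norm_bound_iff:
  "(\<exists>q C. 0 < q \<and> q < p \<and> C < top \<and> (\<forall>E \<in> sets lebesgue.
      weak_lorentz_norm u w q (maximal_function (indicator E)) \<le> C * lorentz_norm u w q (indicator E)))
    \<longleftrightarrow> self_improving_weak_type p"
proof
  assume "\<exists>q C. 0 < q \<and> q < p \<and> C < top \<and> (\<forall>E \<in> sets lebesgue.
      weak_lorentz_norm u w q (maximal_function (indicator E)) \<le> C * lorentz_norm u w q (indicator E))"
  then obtain q C where q: "0 < q" "q < p" and C: "C < top" and le: "\<And>E. E \<in> sets lebesgue \<Longrightarrow>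
      weak_lorentz_norm u w q (maximal_function (indicator E)) \<le> C * lorentz_norm u w q (indicator E)"
    by blast
  obtain c where c: "0 < c" "C \<le> ennreal c" using ennreal_le_real_bound[OF C] .
  have "restricted_weak_type q (c powr q)"
  proof (rule restricted_weak_typeI)
    fix E :: "(real ^ 'n) set" and s t :: real
    assume E: "E \<in> sets lebesgue" and s: "0 < s" and t: "0 < t"
      and st: "ennreal s \<le> rearrangement u (maximal_function (indicator E)) t"
    have "ennreal s * ennreal_powr (primitive w (ennreal t)) (1 / q) \<le>
        ennreal_powr (primitive w (ennreal t)) (1 / q) * rearrangement u (maximal_function (indicator E)) t"
      using st by (subst mult.commute) (rule mult_left_mono, simp_all)
    also have "\<dots> \<le> weak_lorentz_norm u w q (maximal_function (indicator E))"
      unfolding weak_lorentz_norm_def using t by (intro SUP_upper) simp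
    also have "\<dots> \<le> C * ennreal_powr (\<phi> E) (1 / q)"
      using le[OF E] q by (simp add: lorentz_norm_indicator)
    also have "\<dots> \<le> ennreal c * ennreal_powr (\<phi> E) (1 / q)"
      using c by (intro mult_right_mono) auto
    finally have "ennreal_powr (primitive w (ennreal t)) (1 / q) \<le>
        ennreal (1 / s) * (ennreal c * ennreal_powr (\<phi> E) (1 / q))"
      using s by (intro ennreal_mult_le_imp_le)
    also have "\<dots> = ennreal (c / s) * ennreal_powr (\<phi> E) (1 / q)"
      using s c by (subst ennreal_mult_mult) auto
    finally have "primitive w (ennreal t) \<le> ennreal ((c / s) powr q) * \<phi> E"
      using s c q by (subst (asm) ennreal_powr_le_iff) auto
    also have "(c / s) powr q = c powr q * s powr - q"
      using s c by (simp add: powr_divide powr_minus_divide)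
    finally show "primitive w (ennreal t) \<le> ennreal (c powr q * s powr - q) * \<phi> E" .
  qed
  moreover have "0 < c powr q" using c by simp
  ultimately show "self_improving_weak_type p" using q unfolding self_improving_weak_type_def by blast
next
  assume "self_improving_weak_type p"
  then obtain q C where q: "0 < q" "q < p" and C: "0 < C" and weak: "restricted_weak_type q C"
    by (auto simp: self_improving_weak_type_def)
  have "weak_lorentz_norm u w q (maximal_function (indicator E)) \<le>
      ennreal (2 * C powr (1 / q)) * lorentz_norm u w q (indicator E)"
    if E: "E \<in> sets lebesgue" for E
    unfolding weak_lorentz_norm_def lorentz_norm_indicator[OF q(1)]
  proof (rule SUP_least)
    fix t :: real
    have "rearrangement u (maximal_function (indicator E)) t \<noteq> top"
      using rearrangement_maximal_function_le_1[OF E, of t] by (auto simp: top_unique)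
    then obtain r where r: "rearrangement u (maximal_function (indicator E)) t = ennreal r" "0 \<le> r"
      by (cases "rearrangement u (maximal_function (indicator E)) t") auto
    show "ennreal_powr (primitive w (ennreal t)) (1 / q) * rearrangement u (maximal_function (indicator E)) t
        \<le> ennreal (2 * C powr (1 / q)) * ennreal_powr (\<phi> E) (1 / q)"
    proof (cases "r = 0")
      case False
      then have r0: "0 < r" using r by simp
      \<comment> \<open>The q-th root of the constant at height r / 2. Multiplication by r cancels
        the dependence on r.\<close>
      define c where "c = C powr (1 / q) * (2 / r)"
      have c: "0 < c" using C r0 by (simp add: c_def)
      have "primitive w (ennreal t) \<le> ennreal (C * (r / 2) powr - q) * \<phi> E"
        using weak E r(1) r0 by (rule primitive_le_of_rearrangement)
      also have "C * (r / 2) powr - q = c powr q"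
        unfolding c_def using C r0 q by (simp add: powr_mult powr_powr powr_divide powr_minus_divide)
      finally have "ennreal_powr (primitive w (ennreal t)) (1 / q) \<le> ennreal c * ennreal_powr (\<phi> E) (1 / q)"
        using c q by (subst ennreal_powr_le_iff)
      then have "ennreal r * ennreal_powr (primitive w (ennreal t)) (1 / q) \<le>
          ennreal r * (ennreal c * ennreal_powr (\<phi> E) (1 / q))"
        by (rule mult_left_mono) simp
      also have "\<dots> = ennreal (r * c) * ennreal_powr (\<phi> E) (1 / q)"
        using c r by (intro ennreal_mult_mult) auto
      also have "r * c = 2 * C powr (1 / q)" using r0 by (simp add: c_def)
      finally show ?thesis by (simp add: r(1) mult.commute)
    qed (simp add: r)
  qed
  then show "\<exists>q C. 0 < q \<and> q < p \<and> C < top \<and> (\<forall>E \<in> sets lebesgue.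
      weak_lorentz_norm u w q (maximal_function (indicator E)) \<le> C * lorentz_norm u w q (indicator E))"
    using q by (intro exI[of _ q] exI[of _ "ennreal (2 * C powr (1 / q))"]) auto
qed

lemma rearrangement_bound_iff:
  "(\<exists>q C. 0 < q \<and> q < p \<and> C < top \<and> (\<forall>t>0. \<forall>E \<in> sets lebesgue.
      ennreal_powr (rearrangement u (maximal_function (indicator E)) t) q
        \<le> C * (primitive w (weight_measure u E) / primitive w (ennreal t))))
    \<longleftrightarrow> self_improving_weak_type p"
proof
  assume "\<exists>q C. 0 < q \<and> q < p \<and> C < top \<and> (\<forall>t>0. \<forall>E \<in> sets lebesgue.
      ennreal_powr (rearrangement u (maximal_function (indicator E)) t) q
        \<le> C * (primitive w (weight_measure u E) / primitive w (ennreal t)))"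
  then obtain q C where q: "0 < q" "q < p" and C: "C < top" and le: "\<And>t E. 0 < t \<Longrightarrow> E \<in> sets lebesgue \<Longrightarrow>
      ennreal_powr (rearrangement u (maximal_function (indicator E)) t) q \<le> C * (\<phi> E / primitive w (ennreal t))"
    unfolding \<phi>_def by blast
  obtain c where c: "0 < c" "C \<le> ennreal c" using ennreal_le_real_bound[OF C] .
  have "restricted_weak_type q c"
  proof (rule restricted_weak_typeI)
    fix E :: "(real ^ 'n) set" and s t :: real
    assume E: "E \<in> sets lebesgue" and s: "0 < s" and t: "0 < t"
      and st: "ennreal s \<le> rearrangement u (maximal_function (indicator E)) t"
    show "primitive w (ennreal t) \<le> ennreal (c * s powr - q) * \<phi> E"
    proof (cases "primitive w (ennreal t) = 0")
      case False
      have "ennreal (s powr q) = ennreal_powr (ennreal s) q" using s by (simp add: ennreal_powr_ennreal)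
      also have "\<dots> \<le> ennreal_powr (rearrangement u (maximal_function (indicator E)) t) q"
        using st q by (intro ennreal_powr_mono) auto
      also have "\<dots> \<le> C * (\<phi> E / primitive w (ennreal t))" using t E by (rule le)
      also have "\<dots> \<le> ennreal c * (\<phi> E / primitive w (ennreal t))" using c by (intro mult_right_mono) auto
      finally have "ennreal (s powr q) * primitive w (ennreal t) \<le> ennreal c * (\<phi> E / primitive w (ennreal t)) * primitive w (ennreal t)"
        by (rule mult_right_mono) simp
      also have "\<dots> = ennreal c * \<phi> E"
        using False primitive_finite[of t] by (simp add: mult.assoc ennreal_divide_times)
      finally have "primitive w (ennreal t) \<le> ennreal (1 / s powr q) * (ennreal c * \<phi> E)"
        using s by (intro ennreal_mult_le_imp_le) auto
      also have "\<dots> = ennreal (c * s powr - q) * \<phi> E"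
        using s c by (subst ennreal_mult_mult) (auto simp: powr_minus_divide)
      finally show ?thesis .
    qed simp
  qed
  then show "self_improving_weak_type p" using q c unfolding self_improving_weak_type_def by blast
next
  assume "self_improving_weak_type p"
  then obtain q C where q: "0 < q" "q < p" and C: "0 < C" and weak: "restricted_weak_type q C"
    by (auto simp: self_improving_weak_type_def)
  obtain D where D: "1 \<le> D" "\<And>t. primitive w (2 * t) \<le> ennreal D * primitive w t"
    using primitive_doubling[OF weak C] by blast
  have "ennreal_powr (rearrangement u (maximal_function (indicator E)) t) q
      \<le> ennreal (C * 2 powr q) * (primitive w (weight_measure u E) / primitive w (ennreal t))"
    if t: "0 < t" and E: "E \<in> sets lebesgue" for t E
  proof -
    have "rearrangement u (maximal_function (indicator E)) t \<noteq> top"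
      using rearrangement_maximal_function_le_1[OF E, of t] by (auto simp: top_unique)
    then obtain r where r: "rearrangement u (maximal_function (indicator E)) t = ennreal r" "0 \<le> r"
      by (cases "rearrangement u (maximal_function (indicator E)) t") auto
    show ?thesis
    proof (cases "r = 0")
      case False
      then have r0: "0 < r" using r by simp
      \<comment> \<open>Positivity rests on doubling. If W(t) and \<phi>(E) both vanished, the
        quotient 0 / 0 = 0 would force the rearrangement to vanish at t.\<close>
      have W: "primitive w (ennreal t) \<noteq> 0" "primitive w (ennreal t) \<noteq> top"
        using primitive_pos[OF D, of "ennreal t"] t primitive_finite[of t] by auto
      have "primitive w (ennreal t) \<le> ennreal (C * (r / 2) powr - q) * \<phi> E"
        using weak E r(1) r0 by (rule primitive_le_of_rearrangement)
      then have "ennreal (r powr q) * primitive w (ennreal t) \<le> ennreal (r powr q) * (ennreal (C * (r / 2) powr - q) * \<phi> E)"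
        by (rule mult_left_mono) simp
      also have "\<dots> = ennreal (r powr q * (C * (r / 2) powr - q)) * \<phi> E"
        using C by (intro ennreal_mult_mult) auto
      also have "r powr q * (C * (r / 2) powr - q) = C * 2 powr q"
        using r0 by (simp add: powr_divide powr_minus_divide)
      finally have "ennreal (r powr q) * primitive w (ennreal t) / primitive w (ennreal t) \<le>
          ennreal (C * 2 powr q) * \<phi> E / primitive w (ennreal t)"
        by (rule divide_right_mono_ennreal)
      then show ?thesis
        using W r by (simp add: ennreal_mult_divide_eq ennreal_times_divide ennreal_powr_ennreal \<phi>_def)
    qed (simp add: r)
  qed
  then show "\<exists>q C. 0 < q \<and> q < p \<and> C < top \<and> (\<forall>t>0. \<forall>E \<in> sets lebesgue.
      ennreal_powr (rearrangement u (maximal_function (indicator E)) t) q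
        \<le> C * (primitive w (weight_measure u E) / primitive w (ennreal t)))"
    using q by (intro exI[of _ q] exI[of _ "ennreal (C * 2 powr q)"]) auto
qed

text \<open>From families to level sets: countably many cubes in which E has density above s exhaust
  \<open>Mset E s\<close>, and the family bound with \<open>E \<inter> Q j\<close> controls the
  finite unions. Conversely, a bound on all ratios places the cubes in a single level set of the
  union of the \<open>E j\<close>.\<close>

lemma cube_families_bound_iff:
  "(\<exists>q C. 0 < q \<and> q < p \<and> C < top \<and>
      (\<forall>(J::nat) (Q :: nat \<Rightarrow> (real ^ 'n) set) (E :: nat \<Rightarrow> (real ^ 'n) set).
         1 \<le> J \<longrightarrow> (\<forall>j\<in>{1..J}. cube (Q j) \<and> E j \<in> sets lebesgue \<and> E j \<subseteq> Q j) \<longrightarrow>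
         primitive w (weight_measure u (\<Union>j\<in>{1..J}. Q j))
             / primitive w (weight_measure u (\<Union>j\<in>{1..J}. E j))
           \<le> C * Max ((\<lambda>j. ennreal_powr (emeasure lebesgue (Q j) / emeasure lebesgue (E j)) q) ` {1..J})))
    \<longleftrightarrow> self_improving_weak_type p"
proof
  assume "\<exists>q C. 0 < q \<and> q < p \<and> C < top \<and>
      (\<forall>(J::nat) (Q :: nat \<Rightarrow> (real ^ 'n) set) (E :: nat \<Rightarrow> (real ^ 'n) set).
         1 \<le> J \<longrightarrow> (\<forall>j\<in>{1..J}. cube (Q j) \<and> E j \<in> sets lebesgue \<and> E j \<subseteq> Q j) \<longrightarrow>
         primitive w (weight_measure u (\<Union>j\<in>{1..J}. Q j))
             / primitive w (weight_measure u (\<Union>j\<in>{1..J}. E j))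
           \<le> C * Max ((\<lambda>j. ennreal_powr (emeasure lebesgue (Q j) / emeasure lebesgue (E j)) q) ` {1..J}))"
  then obtain q C where q: "0 < q" "q < p" and C: "C < top"
    and le: "\<And>J (Q :: nat \<Rightarrow> (real ^ 'n) set) E. 1 \<le> J \<Longrightarrow>
        (\<forall>j\<in>{1..J}. cube (Q j) \<and> E j \<in> sets lebesgue \<and> E j \<subseteq> Q j) \<Longrightarrow>
        \<phi> (\<Union>j\<in>{1..J}. Q j) / \<phi> (\<Union>j\<in>{1..J}. E j)
          \<le> C * Max ((\<lambda>j. ennreal_powr (emeasure lebesgue (Q j) / emeasure lebesgue (E j)) q) ` {1..J})"
    unfolding \<phi>_def by blast
  obtain c where c: "0 < c" "C \<le> ennreal c" using ennreal_le_real_bound[OF C] .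
  have "restricted_weak_type q c"
    unfolding restricted_weak_type_def
  proof (intro ballI allI impI)
    fix E :: "(real ^ 'n) set" and s :: real
    assume E: "E \<in> sets lebesgue" and s: "0 < s"
    define \<Q> where "\<Q> = {Q. cube Q \<and> ennreal s * emeasure lebesgue Q < (\<integral>\<^sup>+ y\<in>Q. indicator E y \<partial>lebesgue)}"
    have \<Q>: "cube Q" "ennreal s * emeasure lebesgue Q < emeasure lebesgue (E \<inter> Q)" if "Q \<in> \<Q>" for Q
    proof -
      show "cube Q" using that by (simp add: \<Q>_def)
      have "(\<integral>\<^sup>+ y\<in>Q. indicator E y \<partial>lebesgue) = emeasure lebesgue (E \<inter> Q)"
        using E sets_cube[OF \<open>cube Q\<close>] by (subst indicator_inter_arith[symmetric]) (simp add: sets.Int)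
      then show "ennreal s * emeasure lebesgue Q < emeasure lebesgue (E \<inter> Q)" using that by (simp add: \<Q>_def)
    qed
    have M: "Mset E s = \<Union>(interior ` \<Q>)"
      using s by (simp add: superlevel_eq_UN_interior \<Q>_def)
    obtain \<F> where \<F>: "\<F> \<subseteq> interior ` \<Q>" "countable \<F>" "\<Union>\<F> = \<Union>(interior ` \<Q>)"
      using Lindelof[of "interior ` \<Q>"] by auto
    then obtain \<Q>' where \<Q>': "\<Q>' \<subseteq> \<Q>" "countable \<Q>'" "\<F> = interior ` \<Q>'"
      using countable_subset_image[of \<F> interior \<Q>] by auto
    show "\<phi> (Mset E s) \<le> ennreal (c * s powr - q) * \<phi> E"
    proof (cases "\<Q>' = {}")
      case True
      then have "Mset E s = {}" using M \<F> \<Q>' by simp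
      then show ?thesis by simp
    next
      case False
      \<comment> \<open>The shift is due to families being indexed from 1. A finite collection of
        cubes is enumerated with repetitions, which does no harm to the unions.\<close>
      define R where "R j = from_nat_into \<Q>' (j - 1)" for j
      have R: "R j \<in> \<Q>" for j using from_nat_into[OF False] \<Q>'(1) by (auto simp: R_def)
      define A where "A J = (\<Union>j\<in>{1..Suc J}. R j)" for J
      have A: "A J \<in> sets lebesgue" for J
        unfolding A_def using R \<Q>(1) by (intro sets.finite_UN) (auto intro: sets_cube)
      have "\<phi> (A J) \<le> ennreal (c * s powr - q) * \<phi> E" for J
      proof -
        have "\<phi> (\<Union>j\<in>{1..Suc J}. R j) / \<phi> (\<Union>j\<in>{1..Suc J}. E \<inter> R j)
            \<le> C * Max ((\<lambda>j. ennreal_powr (emeasure lebesgue (R j) / emeasure lebesgue (E \<inter> R j)) q) ` {1..Suc J})"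
        proof (rule le)
          show "\<forall>j\<in>{1..Suc J}. cube (R j) \<and> E \<inter> R j \<in> sets lebesgue \<and> E \<inter> R j \<subseteq> R j"
            using R \<Q>(1) E by (metis inf.cobounded2 sets.Int sets_cube)
        qed simp
        also have "\<dots> \<le> ennreal c * ennreal ((1 / s) powr q)"
        proof (rule mult_mono)
          show "Max ((\<lambda>j. ennreal_powr (emeasure lebesgue (R j) / emeasure lebesgue (E \<inter> R j)) q) ` {1..Suc J})
              \<le> ennreal ((1 / s) powr q)"
          proof (rule Max.boundedI)
            fix z assume "z \<in> (\<lambda>j. ennreal_powr (emeasure lebesgue (R j) / emeasure lebesgue (E \<inter> R j)) q) ` {1..Suc J}"
            then obtain j where z: "z = ennreal_powr (emeasure lebesgue (R j) / emeasure lebesgue (E \<inter> R j)) q" by auto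
            have "ennreal s * emeasure lebesgue (R j) \<le> emeasure lebesgue (E \<inter> R j)"
              using \<Q>(2)[OF R[of j]] by simp
            then have "emeasure lebesgue (R j) \<le> ennreal (1 / s) * emeasure lebesgue (E \<inter> R j)"
              using s by (intro ennreal_mult_le_imp_le)
            then have "emeasure lebesgue (R j) / emeasure lebesgue (E \<inter> R j) \<le> ennreal (1 / s)"
              by (rule divide_le_of_le_mult_ennreal)
            then have "z \<le> ennreal_powr (ennreal (1 / s)) q"
              unfolding z using q by (intro ennreal_powr_mono) auto
            then show "z \<le> ennreal ((1 / s) powr q)" using s by (simp add: ennreal_powr_ennreal)
          qed auto
        qed (use c in auto)
        also have "\<dots> = ennreal (c * s powr - q)"
          using c s by (simp add: ennreal_mult[symmetric] powr_divide powr_minus_divide)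
        finally have "\<phi> (A J) \<le> ennreal (c * s powr - q) * \<phi> (\<Union>j\<in>{1..Suc J}. E \<inter> R j)"
          unfolding A_def using c s by (intro le_mult_of_divide_le_ennreal) auto
        also have "\<dots> \<le> ennreal (c * s powr - q) * \<phi> E"
          by (intro mult_left_mono phi_mono) auto
        finally show ?thesis .
      qed
      moreover have "incseq A"
        unfolding incseq_def A_def by (intro allI impI UN_mono) auto
      ultimately have "\<phi> (\<Union>J. A J) \<le> ennreal (c * s powr - q) * \<phi> E"
        using A by (intro phi_UN_le) auto
      moreover have "Mset E s \<subseteq> (\<Union>J. A J)"
      proof
        fix x assume "x \<in> Mset E s"
        then have "x \<in> \<Union>(interior ` \<Q>')" unfolding M \<F>(3)[symmetric] \<Q>'(3) .
        then obtain Q where Q: "Q \<in> \<Q>'" "x \<in> interior Q" by blast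
        obtain n where "from_nat_into \<Q>' n = Q" using from_nat_into_surj[OF \<Q>'(2) Q(1)] by auto
        then have "R (Suc n) = Q" by (simp add: R_def)
        then have "x \<in> A n" using Q(2) interior_subset[of Q] by (auto simp: A_def intro!: bexI[of _ "Suc n"])
        then show "x \<in> (\<Union>J. A J)" by blast
      qed
      ultimately show ?thesis using phi_mono order_trans by blast
    qed
  qed
  then show "self_improving_weak_type p" using q c unfolding self_improving_weak_type_def by blast
next
  assume "self_improving_weak_type p"
  then obtain q C where q: "0 < q" "q < p" and C: "0 < C" and weak: "restricted_weak_type q C"
    by (auto simp: self_improving_weak_type_def)
  have "\<phi> (\<Union>j\<in>{1..J}. Q j) / \<phi> (\<Union>j\<in>{1..J}. E j)
      \<le> ennreal (C * 2 powr q) * Max ((\<lambda>j. ennreal_powr (emeasure lebesgue (Q j) / emeasure lebesgue (E j)) q) ` {1..J})"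
    if J: "1 \<le> J" and QE: "\<forall>j\<in>{1..J}. cube (Q j) \<and> E j \<in> sets lebesgue \<and> E j \<subseteq> Q j"
    for J :: nat and Q E :: "nat \<Rightarrow> (real ^ 'n) set"
  proof -
    define m where "m = Max ((\<lambda>j. ennreal_powr (emeasure lebesgue (Q j) / emeasure lebesgue (E j)) q) ` {1..J})"
    have mj: "ennreal_powr (emeasure lebesgue (Q j) / emeasure lebesgue (E j)) q \<le> m" if "j \<in> {1..J}" for j
      unfolding m_def using that by (intro Max_ge) auto
    show ?thesis
    proof (cases "m = top")
      case True
      then show ?thesis unfolding m_def[symmetric] using C by (simp add: ennreal_mult_top)
    next
      case False
      then obtain m' where m': "m = ennreal m'" "0 \<le> m'" by (cases m) auto
      define r where "r = m' powr (1 / q)"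
      have ratio: "emeasure lebesgue (Q j) / emeasure lebesgue (E j) \<le> ennreal r" if "j \<in> {1..J}" for j
      proof -
        have "ennreal_powr (ennreal_powr (emeasure lebesgue (Q j) / emeasure lebesgue (E j)) q) (1 / q) \<le> ennreal_powr m (1 / q)"
          using mj[OF that] q by (intro ennreal_powr_mono) auto
        then show ?thesis using m' q by (simp add: ennreal_powr_powr ennreal_powr_ennreal r_def)
      qed
      have pos: "emeasure lebesgue (E j) \<noteq> 0" "emeasure lebesgue (E j) \<noteq> top" if "j \<in> {1..J}" for j
      proof -
        have Qj: "cube (Q j)" using QE that by blast
        then show "emeasure lebesgue (E j) \<noteq> 0"
          using ratio[OF that] cube_pos[OF Qj] by (auto simp: top_unique)
        have "emeasure lebesgue (E j) \<le> emeasure lebesgue (Q j)"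
          using QE that sets_cube[OF Qj] by (intro emeasure_mono) auto
        then show "emeasure lebesgue (E j) \<noteq> top" using cube_pos[OF Qj] by (auto simp: top_unique)
      qed
      \<comment> \<open>The family is nonempty and both measures in its first ratio are positive and
        finite, so the common bound for the ratios is positive.\<close>
      have r: "0 < r"
      proof (rule ccontr)
        assume "\<not> 0 < r"
        then have "ennreal r = 0" by (simp add: ennreal_neg)
        then show False using ratio[of 1] pos[of 1] J QE cube_pos[of "Q 1"] by auto
      qed
      define U where "U = (\<Union>j\<in>{1..J}. E j)"
      have U: "U \<in> sets lebesgue" unfolding U_def using QE by (intro sets.finite_UN) auto
      \<comment> \<open>Each \<open>E j\<close> has density at least 1 / r in its cube; the factor 2
        makes the inequality strict.\<close>
      define s where "s = 1 / (2 * r)"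
      have s: "0 < s" using r by (simp add: s_def)
      have "Q j \<subseteq> Mset U s" if j: "j \<in> {1..J}" for j
      proof
        fix x assume x: "x \<in> Q j"
        have Qj: "cube (Q j)" using QE j by blast
        have Ej: "E j \<subseteq> U \<inter> Q j" using QE j by (auto simp: U_def)
        have "emeasure lebesgue (Q j) \<le> ennreal r * emeasure lebesgue (E j)"
          using ratio[OF j] r by (rule le_mult_of_divide_le_ennreal)
        then have "ennreal s * emeasure lebesgue (Q j) \<le> ennreal s * (ennreal r * emeasure lebesgue (E j))"
          by (rule mult_left_mono) simp
        also have "\<dots> = ennreal (1 / 2) * emeasure lebesgue (E j)"
          using s r by (subst ennreal_mult_mult) (auto simp: s_def)
        also have "\<dots> < 1 * emeasure lebesgue (E j)"
        proof -
          have "ennreal (1 / 2) < ennreal 1" by (rule ennreal_lessI) simp_all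
          then have "emeasure lebesgue (E j) * ennreal (1 / 2) < emeasure lebesgue (E j) * 1"
            using pos[OF j] unfolding ennreal_1
            by (intro ennreal_mult_strict_left_mono) (auto simp: zero_less_iff_neq_zero top.not_eq_extremum)
          then show ?thesis by (simp only: mult.commute)
        qed
        also have "\<dots> \<le> emeasure lebesgue (U \<inter> Q j)"
          using Ej U sets_cube[OF Qj] by (simp add: emeasure_mono)
        finally show "x \<in> Mset U s" using x Qj U by (auto simp: Mset_eq)
      qed
      then have "\<phi> (\<Union>j\<in>{1..J}. Q j) \<le> \<phi> (Mset U s)" by (intro phi_mono UN_least)
      also have "\<dots> \<le> ennreal (C * s powr - q) * \<phi> U" using weak U s by (simp add: restricted_weak_type_def)
      also have "s powr - q = 2 powr q * m'"
        using r m' q by (simp add: s_def r_def powr_minus_divide powr_divide powr_mult powr_powr)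
      also have "ennreal (C * (2 powr q * m')) = ennreal (C * 2 powr q) * m"
        using C m' by (simp add: ennreal_mult[symmetric] mult.assoc)
      finally show ?thesis unfolding m_def[symmetric] U_def by (rule divide_le_of_le_mult_ennreal)
    qed
  qed
  note le = this
  show "\<exists>q C. 0 < q \<and> q < p \<and> C < top \<and>
      (\<forall>(J::nat) (Q :: nat \<Rightarrow> (real ^ 'n) set) (E :: nat \<Rightarrow> (real ^ 'n) set).
         1 \<le> J \<longrightarrow> (\<forall>j\<in>{1..J}. cube (Q j) \<and> E j \<in> sets lebesgue \<and> E j \<subseteq> Q j) \<longrightarrow>
         primitive w (weight_measure u (\<Union>j\<in>{1..J}. Q j))
             / primitive w (weight_measure u (\<Union>j\<in>{1..J}. E j))
           \<le> C * Max ((\<lambda>j. ennreal_powr (emeasure lebesgue (Q j) / emeasure lebesgue (E j)) q) ` {1..J}))"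
  proof (intro exI[of _ q] exI[of _ "ennreal (C * 2 powr q)"] conjI allI impI)
    fix J :: nat and Q E :: "nat \<Rightarrow> (real ^ 'n) set"
    assume "1 \<le> J" "\<forall>j\<in>{1..J}. cube (Q j) \<and> E j \<in> sets lebesgue \<and> E j \<subseteq> Q j"
    then show "primitive w (weight_measure u (\<Union>j\<in>{1..J}. Q j))
             / primitive w (weight_measure u (\<Union>j\<in>{1..J}. E j))
           \<le> ennreal (C * 2 powr q) * Max ((\<lambda>j. ennreal_powr (emeasure lebesgue (Q j) / emeasure lebesgue (E j)) q) ` {1..J})"
      using le unfolding \<phi>_def by blast
  qed (use q in auto)
qed

end

theorem theorem3p3p5:
  fixes u :: "real ^ 'n \<Rightarrow> real" and w :: "real \<Rightarrow> real" and p :: real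
  assumes "weight u" and "half_line_weight u w" and "0 < p"
  defines "i \<equiv> bounded_operator maximal_function (lorentz_norm u w p) (lorentz_norm u w p)"
    and "ii \<equiv> (\<exists>C<top. \<forall>E \<in> sets lebesgue.
      lorentz_norm u w p (maximal_function (indicator E)) \<le> C * lorentz_norm u w p (indicator E))"
    and "iii \<equiv> (\<exists>q. 0 < q \<and> q < p \<and>
      bounded_operator maximal_function (lorentz_norm u w q) (lorentz_norm u w q))"
    and "iv \<equiv> (\<exists>q C. 0 < q \<and> q < p \<and> C < top \<and> (\<forall>E \<in> sets lebesgue.
      weak_lorentz_norm u w q (maximal_function (indicator E)) \<le> C * lorentz_norm u w q (indicator E)))"
    and "v \<equiv> (\<exists>q C. 0 < q \<and> q < p \<and> C < top \<and>
      (\<forall>(J::nat) (Q :: nat \<Rightarrow> (real ^ 'n) set) (E :: nat \<Rightarrow> (real ^ 'n) set).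
         1 \<le> J \<longrightarrow> (\<forall>j\<in>{1..J}. cube (Q j) \<and> E j \<in> sets lebesgue \<and> E j \<subseteq> Q j) \<longrightarrow>
         primitive w (weight_measure u (\<Union>j\<in>{1..J}. Q j))
             / primitive w (weight_measure u (\<Union>j\<in>{1..J}. E j))
           \<le> C * Max ((\<lambda>j. ennreal_powr (emeasure lebesgue (Q j) / emeasure lebesgue (E j)) q) ` {1..J})))"
    and "vi \<equiv> (\<exists>q C. 0 < q \<and> q < p \<and> C < top \<and>
      (\<forall>t>0. \<forall>E \<in> sets lebesgue.
         ennreal_powr (rearrangement u (maximal_function (indicator E)) t) q
           \<le> C * (primitive w (weight_measure u E) / primitive w (ennreal t))))"
  shows "(i \<longleftrightarrow> ii) \<and> (i \<longleftrightarrow> iii) \<and> (i \<longleftrightarrow> iv) \<and> (i \<longleftrightarrow> v) \<and> (i \<longleftrightarrow> vi)"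
proof -
  interpret lorentz_weights u w using assms(1,2) by unfold_locales
  have "i \<Longrightarrow> ii"
  proof -
    assume i
    then obtain C where "C < top" "\<And>E. E \<in> sets lebesgue \<Longrightarrow>
        lorentz_norm u w p (maximal_function (indicator E)) \<le> C * lorentz_norm u w p (indicator E)"
      unfolding i_def by (rule bounded_operator_indicator[OF \<open>0 < p\<close>]) (rule that)
    then show ii unfolding ii_def by metis
  qed
  moreover have "ii \<Longrightarrow> self_improving_weak_type p"
  proof -
    assume ii
    then obtain C where "C < top" "\<And>E. E \<in> sets lebesgue \<Longrightarrow>
        lorentz_norm u w p (maximal_function (indicator E)) \<le> C * lorentz_norm u w p (indicator E)"
      unfolding ii_def by metis
    then show "self_improving_weak_type p" by (rule self_improving_weak_typeI[OF \<open>0 < p\<close>])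
  qed
  moreover have "self_improving_weak_type p \<Longrightarrow> i"
    unfolding i_def self_improving_weak_type_def by (metis bounded_operator_of_restricted_weak_type)
  moreover have "self_improving_weak_type p \<Longrightarrow> iii"
  proof -
    assume "self_improving_weak_type p"
    then obtain q C where q: "0 < q" "q < p" "0 < C" "restricted_weak_type q C"
      by (auto simp: self_improving_weak_type_def)
    \<comment> \<open>The weak type estimate with exponent q yields the strong type only for
      exponents above q, so an intermediate exponent is taken.\<close>
    then obtain r where "q < r" "r < p" using dense by blast
    then show iii unfolding iii_def using q bounded_operator_of_restricted_weak_type[of q C r]
      by (intro exI[of _ r]) auto
  qed
  moreover have "iii \<Longrightarrow> self_improving_weak_type p"
  proof -
    assume iii
    then obtain q where q: "0 < q" "q < p"
      "bounded_operator maximal_function (lorentz_norm u w q) (lorentz_norm u w q)"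
      by (auto simp: iii_def)
    obtain C where "C < top" "\<And>E. E \<in> sets lebesgue \<Longrightarrow>
        lorentz_norm u w q (maximal_function (indicator E)) \<le> C * lorentz_norm u w q (indicator E)"
      by (rule bounded_operator_indicator[OF q(1,3)]) (rule that)
    then have "self_improving_weak_type q" by (rule self_improving_weak_typeI[OF q(1)])
    then show "self_improving_weak_type p"
      unfolding self_improving_weak_type_def using q(2) by (meson less_trans)
  qed
  moreover have "iv \<longleftrightarrow> self_improving_weak_type p" unfolding iv_def by (rule weak_lorentz_norm_bound_iff)
  moreover have "v \<longleftrightarrow> self_improving_weak_type p" unfolding v_def by (rule cube_families_bound_iff)
  moreover have "vi \<longleftrightarrow> self_improving_weak_type p" unfolding vi_def by (rule rearrangement_bound_iff)
  ultimately show ?thesis by blast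
qed

end
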